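(* Let $\Omega$ and $\Omega'$ be aperiodic repetitive tiling spaces of $\mathbb{R}^d$ with finite local complexity, and let $h:\Omega\to\Omega'$ be a homeomorphism. Then there exist a canonical transversal $\Xi\subset\Omega$, a canonical transversal $\Xi'\subset\Omega'$ and constants $c,C,m,M>0$ such that for all $r$ big enough, $$c\,p_{\Xi'}(mr)\le p_{\Xi}(r)\le C\,p_{\Xi'}(Mr).$$
   Context: Tilings. A tile is a compact subset of $\mathbb{R}^d$ homeomorphic to a closed ball and equal to the closure of its interior (possibly decorated with a label); a prototile is an equivalence class of tiles under translation. For each tiling space a finite collection of prototiles is fixed. A tiling is a collection $T=\{t_i\}_{i\in I}$ of tiles whose translation classes are in this collection, whose union is $\mathbb{R}^d$, and such that $t_i\cap t_j$ has empty interior for $i\neq j$. For $x\in\mathbb{R}^d$, $T-x=\{t_i-x\}_{i\in I}$ (tilings are not identified with their translates). $B(x,r)$ is the ball of centre $x$ and radius $r$, and $T\cap B(x,r)$ denotes the patch of all tiles of $T$ which intersect $B(x,r)$. $T$ is aperiodic if $T-x\neq T$ for all $x\neq 0$; $T$ has finite local complexity (FLC) if for all $R>0$ there are finitely many patches $T\cap B(x,R)$, $x\in\mathbb{R}^d$, up to translation; $T$ is repetitive if for every finite patch $P\subset T$ there is $R>0$ such that a translate of $P$ appears in $T\cap B(x,R)$ for every $x\in\mathbb{R}^d$. Tiling spaces. Define a distance on tilings with the given prototiles by letting $D(T_1,T_2)$ be the minimum of $1/\sqrt2$ and the infimum of all $\varepsilon>0$ for which there are $x_1,x_2\in\mathbb{R}^d$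 with $\|x_i\|\le\varepsilon$ such that $T_1-x_1$ and $T_2-x_2$ agree on $B(0,1/\varepsilon)$. The hull (tiling space) of $T$ is the closure $\Omega=\overline{\{T-x : x\in\mathbb{R}^d\}}$ for $D$; $\mathbb{R}^d$ acts continuously on it by translation. An aperiodic repetitive tiling space with FLC is the hull of an aperiodic, repetitive tiling with FLC. Transversals. A Delaunay set is a uniformly discrete and relatively dense subset of $\mathbb{R}^d$. A local pointing rule on $\Omega$ is a map $\mathcal{D}$ assigning to each $T\in\Omega$ a Delaunay set $\mathcal{D}(T)$, commuting with translations ($\mathcal{D}(T-x)=\mathcal{D}(T)-x$), and local: there are $\rho,R>0$ such that for all $T\in\Omega$, $\mathcal{D}(T)\cap B(0,\rho)$ only depends on $T\cap B(0,R)$. The canonical transversal associated with $\mathcal{D}$ is $\Xi_{\mathcal{D}}=\{T\in\Omega : 0\in\mathcal{D}(T)\}$. Complexity. For a canonical transversal $\Xi$, the complexity function is $p_\Xi(r)=\mathrm{Card}\{T\cap B(0,r) : T\in\Xi\}$. *)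

theory Defs
  imports "HOL-Analysis.Analysis"
begin

section \<open>Tiles and tilings\<close>

text \<open>A possibly decorated tile is a pair of its support and its label; undecorated tiles are the
  case where the label type is \<^typ>\<open>unit\<close>. Translations do not affect labels.\<close>

type_synonym ('a, 'l) tile = "'a set \<times> 'l"

definition is_tile :: "('a::euclidean_space, 'l) tile \<Rightarrow> bool" where
  "is_tile t \<longleftrightarrow> compact (fst t) \<and> fst t homeomorphic cball (0::'a) 1 \<and>
     closure (interior (fst t)) = fst t"

definition shift_tile :: "('a::euclidean_space, 'l) tile \<Rightarrow> 'a \<Rightarrow> ('a, 'l) tile" where
  "shift_tile t x = ((\<lambda>y. y - x) ` fst t, snd t)"

text \<open>\<open>shift T x\<close> is $T - x$.\<close>

definition shift :: "('a::euclidean_space, 'l) tile set \<Rightarrow> 'a \<Rightarrow> ('a, 'l) tile set" where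
  "shift T x = (\<lambda>t. shift_tile t x) ` T"

definition prototile :: "('a::euclidean_space, 'l) tile \<Rightarrow> ('a, 'l) tile set" where
  "prototile t = range (shift_tile t)"

definition prototile_collection :: "('a::euclidean_space, 'l) tile set set \<Rightarrow> bool" where
  "prototile_collection \<P> \<longleftrightarrow> finite \<P> \<and> \<P> \<subseteq> prototile ` Collect is_tile"

text \<open>A tiling is a set rather than an indexed family of tiles. Nothing is lost: tiles have
  nonempty interior, so a family satisfying the condition on intersections has no repetitions.\<close>

definition tilings :: "('a::euclidean_space, 'l) tile set set \<Rightarrow> ('a, 'l) tile set set" where
  "tilings \<P> = {T. (\<forall>t\<in>T. is_tile t \<and> prototile t \<in> \<P>) \<and> (\<Union>t\<in>T. fst t) = UNIV \<and>
     (\<forall>s\<in>T. \<forall>t\<in>T. s \<noteq> t \<longrightarrow> interior (fst s \<inter> fst t) = {})}"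

text \<open>\<open>patch T x r\<close> is $T \cap B(x,r)$: all tiles of \<open>T\<close> that meet the ball.
  Here and below $B(x,r)$ is the open ball.\<close>

definition patch :: "('a::euclidean_space, 'l) tile set \<Rightarrow> 'a \<Rightarrow> real \<Rightarrow> ('a, 'l) tile set" where
  "patch T x r = {t \<in> T. fst t \<inter> ball x r \<noteq> {}}"

definition aperiodic :: "('a::euclidean_space, 'l) tile set \<Rightarrow> bool" where
  "aperiodic T \<longleftrightarrow> (\<forall>x. x \<noteq> 0 \<longrightarrow> shift T x \<noteq> T)"

text \<open>Finiteness up to translation is finiteness of the set of translation classes of patches.\<close>

definition finite_local_complexity :: "('a::euclidean_space, 'l) tile set \<Rightarrow> bool" where
  "finite_local_complexity T \<longleftrightarrow> (\<forall>R>0. finite (range (\<lambda>x. range (shift (patch T x R)))))"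

definition repetitive :: "('a::euclidean_space, 'l) tile set \<Rightarrow> bool" where
  "repetitive T \<longleftrightarrow>
     (\<forall>P. finite P \<and> P \<subseteq> T \<longrightarrow> (\<exists>R>0. \<forall>x. \<exists>y. shift P y \<subseteq> patch T x R))"


section \<open>Tiling spaces\<close>

definition tiling_close ::
    "('a::euclidean_space, 'l) tile set \<Rightarrow> ('a, 'l) tile set \<Rightarrow> real \<Rightarrow> bool" where
  "tiling_close T1 T2 \<epsilon> \<longleftrightarrow> \<epsilon> > 0 \<and> (\<exists>x1 x2. norm x1 \<le> \<epsilon> \<and> norm x2 \<le> \<epsilon> \<and>
     patch (shift T1 x1) 0 (1 / \<epsilon>) = patch (shift T2 x2) 0 (1 / \<epsilon>))"

text \<open>Inserting $1/\sqrt 2$ into the set expresses the minimum of $1/\sqrt 2$ and the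
  infimum also when no \<open>\<epsilon>\<close> is admissible, where the infimum is $+\infty$.\<close>

definition tiling_dist ::
    "('a::euclidean_space, 'l) tile set \<Rightarrow> ('a, 'l) tile set \<Rightarrow> real" where
  "tiling_dist T1 T2 = Inf (insert (1 / sqrt 2) {\<epsilon>. tiling_close T1 T2 \<epsilon>})"

definition tiling_topology ::
    "('a::euclidean_space, 'l) tile set set \<Rightarrow> ('a, 'l) tile set topology" where
  "tiling_topology \<P> = Metric_space.mtopology (tilings \<P>) tiling_dist"

definition tiling_hull ::
    "('a::euclidean_space, 'l) tile set set \<Rightarrow> ('a, 'l) tile set \<Rightarrow> ('a, 'l) tile set set" where
  "tiling_hull \<P> T = tiling_topology \<P> closure_of (range (shift T))"

definition aperiodic_repetitive_FLC_space ::
    "('a::euclidean_space, 'l) tile set set \<Rightarrow> ('a, 'l) tile set set \<Rightarrow> bool" where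
  "aperiodic_repetitive_FLC_space \<P> \<Omega> \<longleftrightarrow>
     (\<exists>T\<in>tilings \<P>. aperiodic T \<and> repetitive T \<and> finite_local_complexity T \<and> \<Omega> = tiling_hull \<P> T)"


section \<open>Transversals and complexity\<close>

definition Delaunay :: "'a::euclidean_space set \<Rightarrow> bool" where
  "Delaunay S \<longleftrightarrow> uniform_discrete S \<and> (\<exists>R>0. \<forall>x. \<exists>y\<in>S. dist x y \<le> R)"

definition local_pointing_rule ::
    "('a::euclidean_space, 'l) tile set set \<Rightarrow> (('a, 'l) tile set \<Rightarrow> 'a set) \<Rightarrow> bool" where
  "local_pointing_rule \<Omega> \<D> \<longleftrightarrow>
     (\<forall>T\<in>\<Omega>. Delaunay (\<D> T)) \<and>
     (\<forall>T\<in>\<Omega>. \<forall>x. \<D> (shift T x) = (\<lambda>y. y - x) ` \<D> T) \<and>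
     (\<exists>\<rho>>0. \<exists>R>0. \<forall>T\<in>\<Omega>. \<forall>T'\<in>\<Omega>.
        patch T 0 R = patch T' 0 R \<longrightarrow> \<D> T \<inter> ball 0 \<rho> = \<D> T' \<inter> ball 0 \<rho>)"

definition canonical_transversal ::
    "('a::euclidean_space, 'l) tile set set \<Rightarrow> ('a, 'l) tile set set \<Rightarrow> bool" where
  "canonical_transversal \<Omega> \<Xi> \<longleftrightarrow>
     (\<exists>\<D>. local_pointing_rule \<Omega> \<D> \<and> \<Xi> = {T \<in> \<Omega>. 0 \<in> \<D> T})"

text \<open>For a canonical transversal of a space with finite local complexity the counted set is
  finite, so the convention that infinite sets have cardinality 0 plays no role.\<close>

definition complexity :: "('a::euclidean_space, 'l) tile set set \<Rightarrow> real \<Rightarrow> nat" where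
  "complexity \<Xi> r = card ((\<lambda>T. patch T 0 r) ` \<Xi>)"


section \<open>The tiling distance is a metric\<close>

text \<open>Hence \<^const>\<open>tiling_topology\<close>, stated through the constants exported from the locale
  \<^locale>\<open>Metric_space\<close>, is a metric topology, and \<^const>\<open>tiling_hull\<close> is a closure in the
  metric sense.\<close>

lemma shift_tile_0: "shift_tile t 0 = t"
  by (simp add: shift_tile_def)

lemma shift_tile_shift_tile: "shift_tile (shift_tile t x) y = shift_tile t (x + y)"
  by (simp add: shift_tile_def image_image algebra_simps)

lemma shift_shift: "shift (shift T x) y = shift T (x + y)"
  by (simp add: shift_def image_image shift_tile_shift_tile)

lemma shift_tile_meets_ball:
  "fst (shift_tile t z) \<inter> ball x r \<noteq> {} \<longleftrightarrow> fst t \<inter> ball (x + z) r \<noteq> {}"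
proof -
  have "y - z \<in> ball x r \<longleftrightarrow> y \<in> ball (x + z) r" for y
    by (simp add: dist_norm algebra_simps)
  then show ?thesis
    unfolding shift_tile_def by auto
qed

lemma patch_shift: "patch (shift T z) x r = shift (patch T (x + z) r) z"
proof -
  have "patch (shift T z) x r = (\<lambda>t. shift_tile t z) ` {t \<in> T. fst (shift_tile t z) \<inter> ball x r \<noteq> {}}"
    unfolding patch_def shift_def by blast
  then show ?thesis
    unfolding shift_tile_meets_ball by (simp add: patch_def shift_def)
qed

lemma patch_eq_subset:
  assumes "patch S x r = patch T x r" "ball y s \<subseteq> ball x r"
  shows "patch S y s = patch T y s"
proof -
  have "patch U y s = {t \<in> patch U x r. fst t \<inter> ball y s \<noteq> {}}" for U :: "('a, 'b) tile set"
    using assms(2) unfolding patch_def by blast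
  with assms(1) show ?thesis
    by simp
qed

lemma bdd_below_close: "bdd_below (insert (1 / sqrt 2) {\<epsilon>. tiling_close S T \<epsilon>})"
  by (rule bdd_belowI[of _ 0]) (auto simp: tiling_close_def)

lemma tiling_dist_le_cap: "tiling_dist S T \<le> 1 / sqrt 2"
  unfolding tiling_dist_def by (rule cInf_lower[OF _ bdd_below_close]) simp

lemma tiling_dist_le: "tiling_close S T \<epsilon> \<Longrightarrow> tiling_dist S T \<le> \<epsilon>"
  unfolding tiling_dist_def by (rule cInf_lower[OF _ bdd_below_close]) simp

lemma tiling_dist_lessD:
  assumes "tiling_dist S T < e" "e \<le> 1 / sqrt 2"
  obtains \<epsilon> where "\<epsilon> < e" "tiling_close S T \<epsilon>"
proof -
  obtain \<epsilon> where "\<epsilon> \<in> insert (1 / sqrt 2) {\<epsilon>. tiling_close S T \<epsilon>}" "\<epsilon> < e"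
    using cInf_lessD[OF _ assms(1)[unfolded tiling_dist_def]] by auto
  with assms(2) that show ?thesis
    by auto
qed

lemma tiling_close_triangle:
  assumes ST: "tiling_close S T a" and TU: "tiling_close T U b" and small: "a + b < 1 / sqrt 2"
  shows "tiling_close S U (a + b)"
proof -
  obtain x1 x2 where x: "norm x1 \<le> a" "norm x2 \<le> a"
    and px: "patch (shift S x1) 0 (1 / a) = patch (shift T x2) 0 (1 / a)" and a: "a > 0"
    using ST by (auto simp: tiling_close_def)
  obtain y2 y3 where y: "norm y2 \<le> b" "norm y3 \<le> b"
    and py: "patch (shift T y2) 0 (1 / b) = patch (shift U y3) 0 (1 / b)" and b: "b > 0"
    using TU by (auto simp: tiling_close_def)
  have "(a + b)\<^sup>2 \<le> (1 / sqrt 2)\<^sup>2"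
    using small a b by (intro power_mono) auto
  then have sq: "(a + b) * (a + b) \<le> 1"
    by (simp add: power2_eq_square field_simps)
  have "a * (a + b) \<le> (a + b) * (a + b)" "b * (a + b) \<le> (a + b) * (a + b)"
    using a b by (auto intro!: mult_right_mono)
  then have sqa: "a * (a + b) \<le> 1" and sqb: "b * (a + b) \<le> 1"
    using sq by linarith+
  have sqa': "b * (a * (a + b)) \<le> b" and sqb': "a * (b * (a + b)) \<le> a"
    using mult_left_mono[OF sqa, of b] mult_left_mono[OF sqb, of a] a b by auto
  have ra: "b + 1 / (a + b) \<le> 1 / a" and rb: "a + 1 / (a + b) \<le> 1 / b"
    using a b sqa' sqb' by (auto simp: field_simps)
  have sub: "ball (0::'a) (1 / (a + b)) \<subseteq> ball (- z) r" if "norm z + 1 / (a + b) \<le> r" for z r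
  proof
    fix w :: 'a
    assume "w \<in> ball 0 (1 / (a + b))"
    moreover have "dist (- z) w \<le> norm z + norm w"
      using norm_triangle_ineq[of z w] by (metis diff_minus_eq_add dist_norm minus_diff_eq norm_minus_cancel add.commute uminus_add_conv_diff)
    ultimately show "w \<in> ball (- z) r"
      using that by simp
  qed
  have "patch (shift S (x1 + y2)) (- y2) (1 / a) = patch (shift T (x2 + y2)) (- y2) (1 / a)"
    using px patch_shift[of "shift S x1" y2 "- y2"] patch_shift[of "shift T x2" y2 "- y2"]
    by (simp add: shift_shift)
  then have 1: "patch (shift S (x1 + y2)) 0 (1 / (a + b)) = patch (shift T (x2 + y2)) 0 (1 / (a + b))"
    by (rule patch_eq_subset) (use sub ra y in auto)
  have "patch (shift T (y2 + x2)) (- x2) (1 / b) = patch (shift U (y3 + x2)) (- x2) (1 / b)"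
    using py patch_shift[of "shift T y2" x2 "- x2"] patch_shift[of "shift U y3" x2 "- x2"]
    by (simp add: shift_shift)
  then have 2: "patch (shift T (y2 + x2)) 0 (1 / (a + b)) = patch (shift U (y3 + x2)) 0 (1 / (a + b))"
    by (rule patch_eq_subset) (use sub rb x in auto)
  have "norm (x1 + y2) \<le> a + b" "norm (y3 + x2) \<le> a + b"
    using x y norm_triangle_ineq[of x1 y2] norm_triangle_ineq[of y3 x2] by linarith+
  with 1 2 a b show ?thesis
    unfolding tiling_close_def by (metis add.commute add_pos_pos)
qed

lemma is_tile_interior_nonempty:
  assumes "is_tile t" shows "interior (fst t) \<noteq> {}"
proof
  assume "interior (fst t) = {}"
  then have "fst t = {}"
    using assms unfolding is_tile_def by auto
  then show False
    using assms homeomorphic_empty(1)[of "cball 0 1"] unfolding is_tile_def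
    by (metis centre_in_cball empty_iff homeomorphic_empty(2) homeomorphic_sym zero_le_one)
qed

lemma tiling_dist_0_subset:
  assumes S: "S \<in> tilings \<P>" and T: "T \<in> tilings \<P>" and 0: "tiling_dist S T = 0"
  shows "S \<subseteq> T"
proof
  fix t assume t: "t \<in> S"
  then have "is_tile t"
    using S by (auto simp: tilings_def)
  then obtain p where p: "p \<in> interior (fst t)"
    using is_tile_interior_nonempty by blast
  then obtain e where e: "e > 0" "ball p e \<subseteq> fst t"
    by (meson mem_interior)
  have near: "\<exists>z. norm z < \<delta> \<and> shift_tile t z \<in> T" if "\<delta> > 0" for \<delta>
  proof -
    define \<eta> where "\<eta> = min (\<delta> / 2) (min (1 / sqrt 2) (1 / (norm p + 2)))"
    have "\<eta> > 0"
      using that by (simp add: \<eta>_def add_nonneg_pos)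
    then obtain a where a: "a < \<eta>" "tiling_close S T a"
      using tiling_dist_lessD[of S T \<eta>] 0 by (metis \<eta>_def min.cobounded1 min.coboundedI2)
    then obtain x1 x2 where x: "a > 0" "norm x1 \<le> a" "norm x2 \<le> a"
      and px: "patch (shift S x1) 0 (1 / a) = patch (shift T x2) 0 (1 / a)"
      by (auto simp: tiling_close_def)
    have "a < 1 / (norm p + 2)" "a < 1"
      using a(1) by (auto simp: \<eta>_def intro: less_le_trans)
    then have "norm p + 2 < 1 / a"
      using x(1) by (simp add: field_simps add_nonneg_pos)
    then have "norm p + norm x1 < 1 / a"
      using x \<open>a < 1\<close> by linarith
    then have "p \<in> ball (0 + x1) (1 / a)"
      using norm_triangle_ineq4[of x1 p] by (simp add: dist_norm)
    then have "fst (shift_tile t x1) \<inter> ball 0 (1 / a) \<noteq> {}"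
      unfolding shift_tile_meets_ball using p interior_subset by blast
    then have "shift_tile t x1 \<in> patch (shift S x1) 0 (1 / a)"
      using t by (auto simp: patch_def shift_def)
    then obtain s where s: "s \<in> T" "shift_tile t x1 = shift_tile s x2"
      unfolding px by (auto simp: patch_def shift_def)
    have "shift_tile t (x1 - x2) = s"
      using arg_cong[OF s(2), of "\<lambda>u. shift_tile u (- x2)"]
      by (simp add: shift_tile_shift_tile shift_tile_0)
    moreover have "norm (x1 - x2) < \<delta>"
      using norm_triangle_ineq4[of x1 x2] x a(1) by (simp add: \<eta>_def)
    ultimately show ?thesis
      using s(1) by blast
  qed
  have same: "shift_tile t z = shift_tile t z'"
    if "shift_tile t z \<in> T" "shift_tile t z' \<in> T" "norm z < e / 2" "norm z' < e / 2" for z z'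
  proof (rule ccontr)
    assume ne: "shift_tile t z \<noteq> shift_tile t z'"
    have b: "ball p (e / 2) \<subseteq> fst (shift_tile t w)" if "norm w < e / 2" for w
    proof
      fix y assume "y \<in> ball p (e / 2)"
      then have "y + w \<in> ball p e"
        using that norm_triangle_ineq4[of "p - y" w] by (simp add: dist_norm algebra_simps)
      then show "y \<in> fst (shift_tile t w)"
        using e(2) unfolding shift_tile_def by (auto intro!: image_eqI[of _ _ "y + w"])
    qed
    have "ball p (e / 2) \<subseteq> interior (fst (shift_tile t z) \<inter> fst (shift_tile t z'))"
      using b that by (intro interior_maximal) auto
    moreover have "interior (fst (shift_tile t z) \<inter> fst (shift_tile t z')) = {}"
      using T that ne by (auto simp: tilings_def)
    ultimately have "ball p (e / 2) = {}"
      by (metis subset_empty)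
    then show False
      using e(1) by simp
  qed
  obtain z where z: "norm z < e / 2" "shift_tile t z \<in> T"
    using near[of "e / 2"] e(1) by auto
  show "t \<in> T"
  proof (cases "z = 0")
    case True
    with z show ?thesis by (simp add: shift_tile_0)
  next
    case False
    obtain z' where z': "norm z' < min (e / 2) (norm z)" "shift_tile t z' \<in> T"
      using near[of "min (e / 2) (norm z)"] e(1) False by auto
    show ?thesis
    proof (cases "z' = 0")
      case True
      with z' show ?thesis by (simp add: shift_tile_0)
    next
      case F': False
      have "shift_tile t z = shift_tile t z'"
        using same[OF z(2) z'(2)] z z' by auto
      then have eq: "shift_tile t (z - z') = t"
        using arg_cong[of _ _ "\<lambda>u. shift_tile u (- z')"]
        by (metis ab_group_add_class.ab_diff_conv_add_uminus right_minus shift_tile_0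
            shift_tile_shift_tile)
      have step: "y - (z - z') \<in> fst t" if "y \<in> fst t" for y
        using that arg_cong[OF eq, of fst] by (auto simp: shift_tile_def)
      have "p - of_nat n *\<^sub>R (z - z') \<in> fst t" for n
      proof (induction n)
        case 0
        show ?case using p interior_subset by auto
      next
        case (Suc n)
        from step[OF this] show ?case by (simp add: algebra_simps)
      qed
      moreover obtain B where B: "\<And>y. y \<in> fst t \<Longrightarrow> norm y \<le> B"
        using \<open>is_tile t\<close> compact_imp_bounded by (metis bounded_iff is_tile_def)
      moreover have "norm (z - z') > 0"
        using z' by auto
      then obtain n where "of_nat n * norm (z - z') > B + norm p"
        using reals_Archimedean3 by blast
      moreover have "norm (of_nat n *\<^sub>R (z - z')) \<le> norm (p - of_nat n *\<^sub>R (z - z')) + norm p"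
        by (metis add.commute norm_minus_commute norm_triangle_sub)
      ultimately show ?thesis
        by (smt (verit) norm_scaleR of_nat_0_le_iff of_nat_id real_norm_def)
    qed
  qed
qed

lemma tiling_close_commute: "tiling_close S T \<epsilon> \<longleftrightarrow> tiling_close T S \<epsilon>"
  unfolding tiling_close_def by metis

lemma tiling_dist_commute: "tiling_dist S T = tiling_dist T S"
  unfolding tiling_dist_def using tiling_close_commute[of S T] by presburger

lemma tiling_dist_nonneg: "tiling_dist S T \<ge> 0"
  unfolding tiling_dist_def by (rule cInf_greatest) (auto simp: tiling_close_def)

lemma Metric_space_tilings: "Metric_space (tilings \<P>) tiling_dist"
proof
  show "0 \<le> tiling_dist S T" for S T :: "('a, 'b) tile set"
    by (rule tiling_dist_nonneg)
  show "tiling_dist S T = tiling_dist T S" for S T :: "('a, 'b) tile set"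
    by (rule tiling_dist_commute)
  show "tiling_dist S T = 0 \<longleftrightarrow> S = T" if "S \<in> tilings \<P>" "T \<in> tilings \<P>" for S T
  proof
    assume "tiling_dist S T = 0"
    with that show "S = T"
      using tiling_dist_0_subset tiling_dist_commute by (metis subset_antisym)
  next
    assume "S = T"
    have "tiling_close S S \<epsilon>" if "\<epsilon> > 0" for \<epsilon>
      using that unfolding tiling_close_def by (intro conjI exI[of _ 0]) auto
    then have "tiling_dist S S \<le> 0"
      by - (rule field_le_epsilon, simp add: tiling_dist_le)
    with \<open>S = T\<close> tiling_dist_nonneg[of S T] show "tiling_dist S T = 0"
      by simp
  qed
  show "tiling_dist S U \<le> tiling_dist S T + tiling_dist T U" for S T U :: "('a, 'b) tile set"
  proof (cases "tiling_dist S T + tiling_dist T U < 1 / sqrt 2")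
    case False
    then show ?thesis
      using tiling_dist_le_cap[of S U] by linarith
  next
    case True
    define g where "g = 1 / sqrt 2 - (tiling_dist S T + tiling_dist T U)"
    have g: "g > 0"
      using True by (simp add: g_def)
    have nn: "tiling_dist S T \<ge> 0" "tiling_dist T U \<ge> 0"
      by (rule tiling_dist_nonneg)+
    show ?thesis
    proof (rule field_le_epsilon)
      fix e :: real assume "e > 0"
      define k where "k = min e g / 2"
      have k: "k > 0" "2 * k \<le> e" "2 * k \<le> g"
        using \<open>e > 0\<close> g by (auto simp: k_def)
      obtain a where a: "a < tiling_dist S T + k" "tiling_close S T a"
        using tiling_dist_lessD[of S T "tiling_dist S T + k"] k nn unfolding g_def by auto
      obtain b where b: "b < tiling_dist T U + k" "tiling_close T U b"
        using tiling_dist_lessD[of T U "tiling_dist T U + k"] k nn unfolding g_def by auto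
      have "a + b < 1 / sqrt 2"
        using a b k unfolding g_def by linarith
      then have "tiling_dist S U \<le> a + b"
        using tiling_close_triangle[OF a(2) b(2)] tiling_dist_le by blast
      then show "tiling_dist S U \<le> tiling_dist S T + tiling_dist T U + e"
        using a b k by linarith
    qed
  qed
qed

end

theory Submission
  imports Defs "HOL-Library.Diagonal_Subsequence"
begin

text \<open>
  Let \<open>\<Xi>\<close> and \<open>\<Xi>'\<close> consist of the tilings that have the puncture of some tile at the origin. The
  heart of the matter is that a homeomorphism preserves agreement on large balls proportionally:
  if two tilings of \<open>\<Omega>\<close> agree on \<open>B(0,r)\<close>, then their images agree on \<open>B(0,mr)\<close> up to a bounded
  translation, with \<open>m\<close> independent of the tilings and of \<open>r\<close>
  (\<open>images_agree_on_proportional_ball\<close>). Given this, a patch of radius \<open>r\<close> in \<open>\<Xi>\<close> determines the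
  patches of radius proportional to \<open>r\<close> of the corresponding tilings in \<open>\<Xi>'\<close> up to a choice among
  boundedly many punctures (\<open>complexity_image_le\<close>). This bounds the complexity of \<open>\<Xi>'\<close> by that of
  \<open>\<Xi>\<close>, and the inverse homeomorphism gives the other inequality.

  Two ingredients produce the proportionality. First, the hulls are compact
  (\<open>compactin_space\<close>), so the homeomorphism and its inverse are uniformly continuous: agreement on
  a ball of some fixed radius implies that the images agree near the origin, up to a tiny
  translation. Second, that translation is unique, because two translates of a tiling by
  different vectors at distance less than \<open>\<delta>\<close> share no tile (\<open>translation_unique\<close>). Uniqueness
  makes local comparisons fit together along a chain of small steps, without accumulating errors.
  Chains of steps inside an orbit show that orbits go to orbits and that small translations go to
  small translations (\<open>small_translations\<close>); chains from the origin outwards transport the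
  comparison of the images across a ball, whose radius is proportional to the number of steps.
\<close>

section \<open>Patches and the tiling distance\<close>

lemma patch_subset: "patch T x r \<subseteq> T"
  by (auto simp: patch_def)

lemma ball_subset_ball:
  fixes x y :: "'a::real_normed_vector"
  assumes "norm (y - x) + s \<le> r"
  shows "ball y s \<subseteq> ball x r"
proof
  fix w assume "w \<in> ball y s"
  then show "w \<in> ball x r"
    using assms dist_triangle[of x w y] by (simp add: dist_norm norm_minus_commute)
qed

lemma patch_agree_shift:
  assumes "patch (shift S a) c r = patch (shift T b) c r"
  shows "patch (shift S (a + z)) (c - z) r = patch (shift T (b + z)) (c - z) r"
  using arg_cong[OF assms, of "\<lambda>Q. shift Q z"]
    patch_shift[of "shift S a" z "c - z" r] patch_shift[of "shift T b" z "c - z" r]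
  by (simp add: shift_shift)

lemma shift_0: "shift T 0 = T"
  by (simp add: shift_def shift_tile_0)

lemma tiling_dist_shift_le: "tiling_dist S (shift S x) \<le> norm x"
proof (cases "x = 0")
  case True
  have "tiling_close S S \<epsilon>" if "\<epsilon> > 0" for \<epsilon>
    using that unfolding tiling_close_def by (intro conjI exI[of _ 0]) auto
  then have "tiling_dist S S \<le> 0"
    by - (rule field_le_epsilon, simp add: tiling_dist_le)
  with True show ?thesis
    by (simp add: shift_0)
next
  case False
  then have "tiling_close S (shift S x) (norm x)"
    unfolding tiling_close_def by (intro conjI exI[of _ x] exI[of _ 0]) (auto simp: shift_0)
  then show ?thesis
    by (rule tiling_dist_le)
qed

lemma tiling_dist_le_of_patch_eq:
  assumes "patch S 0 r = patch T 0 r" "r > 0"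
  shows "tiling_dist S T \<le> 1 / r"
proof -
  have "tiling_close S T (1 / r)"
    using assms unfolding tiling_close_def by (intro conjI exI[of _ 0]) (auto simp: shift_0)
  then show ?thesis
    by (rule tiling_dist_le)
qed

text \<open>The two small translations in the definition of the distance can be moved to one side; the
  radius of agreement shrinks by the length of the translation.\<close>

lemma patch_agree_of_tiling_dist_less:
  assumes "\<kappa> > 0"
  obtains \<epsilon> where "\<epsilon> > 0"
    "\<And>S T :: ('a::euclidean_space, 'l) tile set. tiling_dist S T < \<epsilon> \<Longrightarrow>
       \<exists>z. norm z \<le> \<kappa> \<and> patch (shift S z) 0 r = patch T 0 r"
proof
  define \<epsilon> where "\<epsilon> = min (min (\<kappa> / 2) (1 / sqrt 2)) (1 / (\<bar>r\<bar> + \<kappa>))"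
  show "\<epsilon> > 0"
    using assms by (simp add: \<epsilon>_def)
  fix S T :: "('a, 'l) tile set"
  assume "tiling_dist S T < \<epsilon>"
  moreover have "\<epsilon> \<le> 1 / sqrt 2"
    by (simp add: \<epsilon>_def)
  ultimately obtain a where a: "a < \<epsilon>" "tiling_close S T a"
    by (rule tiling_dist_lessD)
  then obtain u v where uv: "a > 0" "norm u \<le> a" "norm v \<le> a"
    and eq: "patch (shift S u) 0 (1 / a) = patch (shift T v) 0 (1 / a)"
    by (auto simp: tiling_close_def)
  have "a \<le> 1 / (\<bar>r\<bar> + \<kappa>)" "2 * a \<le> \<kappa>"
    using a(1) by (auto simp: \<epsilon>_def)
  then have ra: "\<bar>r\<bar> + \<kappa> \<le> 1 / a"
    using uv(1) assms by (simp add: field_simps)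
  have "patch (shift S (u + - v)) (0 - - v) (1 / a) = patch (shift T (v + - v)) (0 - - v) (1 / a)"
    by (rule patch_agree_shift[OF eq])
  then have "patch (shift S (u - v)) v (1 / a) = patch T v (1 / a)"
    by (simp add: shift_0)
  then have "patch (shift S (u - v)) 0 r = patch T 0 r"
    by (rule patch_eq_subset)
       (use uv ra \<open>2 * a \<le> \<kappa>\<close> in \<open>auto intro!: ball_subset_ball\<close>)
  moreover have "norm (u - v) \<le> \<kappa>"
    using norm_triangle_ineq4[of u v] uv \<open>2 * a \<le> \<kappa>\<close> by linarith
  ultimately show "\<exists>z. norm z \<le> \<kappa> \<and> patch (shift S z) 0 r = patch T 0 r"
    by blast
qed

lemma eq_if_patches_eq:
  fixes S T :: "('a::euclidean_space, 'l) tile set"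
  assumes "\<And>r. r \<ge> r0 \<Longrightarrow> patch S 0 r = patch T 0 r"
    and "\<forall>t\<in>S \<union> T. fst t \<noteq> {}"
  shows "S = T"
proof -
  have *: "t \<in> A \<longleftrightarrow> t \<in> patch A 0 (max r0 (norm p + 1))" if "p \<in> fst t" for A t p
    using that unfolding patch_def by (auto simp: disjoint_iff max_def intro!: bexI[of _ p])
  have "t \<in> S \<longleftrightarrow> t \<in> T" for t
  proof (cases "fst t = {}")
    case True
    with assms(2) show ?thesis by auto
  next
    case False
    then obtain p where "p \<in> fst t" by auto
    with *[of p t] assms(1)[of "max r0 (norm p + 1)"] show ?thesis by auto
  qed
  then show ?thesis by blast
qed

lemma tilingsD:
  assumes "T \<in> tilings \<P>" "t \<in> T"
  shows "is_tile t" "prototile t \<in> \<P>"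
    "s \<in> T \<Longrightarrow> s \<noteq> t \<Longrightarrow> interior (fst s \<inter> fst t) = {}"
  using assms unfolding tilings_def mem_Collect_eq by metis+

lemma tile_nonempty: "T \<in> tilings \<P> \<Longrightarrow> t \<in> T \<Longrightarrow> fst t \<noteq> {}"
  using is_tile_interior_nonempty[OF tilingsD(1)] by fastforce

lemma exists_tile_at:
  assumes "T \<in> tilings \<P>"
  obtains t where "t \<in> T" "x \<in> fst t"
proof -
  have "x \<in> (\<Union>t\<in>T. fst t)"
    using assms unfolding tilings_def by blast
  then show ?thesis
    using that by blast
qed

lemma interior_diff_image:
  fixes A :: "'a::euclidean_space set"
  shows "interior ((\<lambda>y. y - x) ` A) = (\<lambda>y. y - x) ` interior A"
  using interior_translation[of "- x" A] by simp

lemma closure_diff_image: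
  fixes A :: "'a::euclidean_space set"
  shows "closure ((\<lambda>y. y - x) ` A) = (\<lambda>y. y - x) ` closure A"
  using closure_translation[of "- x" A] by simp

lemma is_tile_shift_tile:
  assumes "is_tile t"
  shows "is_tile (shift_tile t x)"
proof -
  have "fst t homeomorphic (\<lambda>y. y - x) ` fst t"
    using homeomorphic_translation[of "fst t" "- x"] by simp
  then have "(\<lambda>y. y - x) ` fst t homeomorphic cball (0::'a) 1"
    using assms homeomorphic_trans homeomorphic_sym unfolding is_tile_def by blast
  moreover have "compact ((\<lambda>y. y - x) ` fst t)"
    using assms compact_translation[of "fst t" "- x"] by (simp add: is_tile_def)
  ultimately show ?thesis
    using assms unfolding is_tile_def shift_tile_def
    by (simp add: interior_diff_image closure_diff_image)
qed

lemma prototile_shift_tile: "prototile (shift_tile t x) = prototile t"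
proof -
  have "shift_tile t y = shift_tile (shift_tile t x) (y - x)" for y
    by (simp add: shift_tile_shift_tile)
  then have "range (shift_tile t) \<subseteq> range (shift_tile (shift_tile t x))"
    by (metis image_subsetI rangeI)
  moreover have "range (shift_tile (shift_tile t x)) \<subseteq> range (shift_tile t)"
    by (simp add: image_subset_iff shift_tile_shift_tile)
  ultimately show ?thesis
    unfolding prototile_def by blast
qed

lemma shift_in_tilings:
  assumes T: "T \<in> tilings \<P>"
  shows "shift T x \<in> tilings \<P>"
proof -
  have "is_tile u \<and> prototile u \<in> \<P>" if u: "u \<in> shift T x" for u
  proof -
    obtain t where "t \<in> T" "u = shift_tile t x"
      using u unfolding shift_def by blast
    then show ?thesis
      using tilingsD[OF T] is_tile_shift_tile prototile_shift_tile by metis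
  qed
  moreover have "(\<Union>t\<in>shift T x. fst t) = UNIV"
  proof -
    have "\<exists>u\<in>shift T x. y \<in> fst u" for y
    proof -
      obtain t where t: "t \<in> T" "y + x \<in> fst t"
        by (rule exists_tile_at[OF assms])
      then have "y \<in> fst (shift_tile t x)"
        unfolding shift_tile_def by (auto intro: image_eqI[of _ _ "y + x"])
      with t(1) show ?thesis
        unfolding shift_def by blast
    qed
    then show ?thesis by blast
  qed
  moreover have "interior (fst u \<inter> fst v) = {}"
    if uv: "u \<in> shift T x" "v \<in> shift T x" "u \<noteq> v" for u v
  proof -
    obtain s t where st: "s \<in> T" "u = shift_tile s x" "t \<in> T" "v = shift_tile t x"
      using uv unfolding shift_def by blast
    with uv(3) have "interior (fst s \<inter> fst t) = {}"
      using tilingsD(3)[OF T] by metis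
    moreover have "fst u \<inter> fst v = (\<lambda>y. y - x) ` (fst s \<inter> fst t)"
      using st by (auto simp: shift_tile_def)
    ultimately show ?thesis
      by (simp add: interior_diff_image)
  qed
  ultimately show ?thesis
    unfolding tilings_def mem_Collect_eq by metis
qed


section \<open>Punctures\<close>

text \<open>A puncture marks each tile by an interior point, in a way that commutes with translations. The
  radius \<open>\<delta>\<close> of a ball inside every tile keeps the punctures of different tiles apart, and the
  radius \<open>D\<close> of a ball around every tile makes the punctures relatively dense. So punctures both
  define a local pointing rule and let the position of a tile be read off from a single vector.\<close>

definition puncturing ::
    "('a::euclidean_space, 'l) tile set set \<Rightarrow> (('a, 'l) tile \<Rightarrow> 'a) \<Rightarrow> real \<Rightarrow> real \<Rightarrow> bool" where
  "puncturing \<P> p \<delta> D \<longleftrightarrow> \<delta> > 0 \<and> D > 0 \<and>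
     (\<forall>t. is_tile t \<and> prototile t \<in> \<P> \<longrightarrow>
        ball (p t) \<delta> \<subseteq> fst t \<and> fst t \<subseteq> ball (p t) D \<and> (\<forall>x. p (shift_tile t x) = p t - x))"

text \<open>The lower corner of the bounding box. It is a canonical point attached to a compact set that
  commutes with translations, which is all that is wanted from it; it may lie outside the set.\<close>

definition box_corner :: "'a::euclidean_space set \<Rightarrow> 'a" where
  "box_corner A = (\<Sum>b\<in>Basis. (INF y\<in>A. y \<bullet> b) *\<^sub>R b)"

lemma box_corner_translate:
  fixes A :: "'a::euclidean_space set"
  assumes "compact A" "A \<noteq> {}"
  shows "box_corner ((\<lambda>y. y - x) ` A) = box_corner A - x"
proof -
  have "(INF y\<in>(\<lambda>y. y - x) ` A. y \<bullet> b) = (INF y\<in>A. y \<bullet> b) - x \<bullet> b" if "b \<in> Basis" for b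
  proof -
    have "continuous_on A (\<lambda>y. y \<bullet> b)"
      by (intro continuous_intros)
    then obtain m where m: "m \<in> A" "\<And>y. y \<in> A \<Longrightarrow> m \<bullet> b \<le> y \<bullet> b"
      using continuous_attains_inf[OF assms] by blast
    have "(INF y\<in>A. y \<bullet> b) = m \<bullet> b"
      using m by (intro cInf_eq_minimum) auto
    moreover have "(INF y\<in>(\<lambda>y. y - x) ` A. y \<bullet> b) = m \<bullet> b - x \<bullet> b"
      using m by (intro cInf_eq_minimum) (auto simp: inner_diff_left image_image)
    ultimately show ?thesis by simp
  qed
  then have "box_corner ((\<lambda>y. y - x) ` A) = (\<Sum>b\<in>Basis. ((INF y\<in>A. y \<bullet> b) - x \<bullet> b) *\<^sub>R b)"
    unfolding box_corner_def by simp
  also have "\<dots> = (\<Sum>b\<in>Basis. (INF y\<in>A. y \<bullet> b) *\<^sub>R b) - (\<Sum>b\<in>Basis. (x \<bullet> b) *\<^sub>R b)"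
    by (simp only: scaleR_left_diff_distrib sum_subtractf)
  finally show ?thesis
    by (simp only: euclidean_representation box_corner_def)
qed

text \<open>The box corner of a tile becomes an interior point after a correction by a vector that depends
  on the prototile only, hence does not disturb the compatibility with translations. Finiteness of
  the collection of prototiles gives the uniform radii.\<close>

lemma exists_puncturing:
  fixes \<P> :: "('a::euclidean_space, 'l) tile set set"
  assumes "prototile_collection \<P>"
  obtains p \<delta> D where "puncturing \<P> p \<delta> D"
proof -
  define q :: "('a, 'l) tile \<Rightarrow> 'a" where "q t = box_corner (fst t)" for t
  have q: "q (shift_tile t x) = q t - x" if "is_tile t" for t x
  proof -
    have "compact (fst t)" "fst t \<noteq> {}"
      using that is_tile_interior_nonempty[OF that] by (auto simp: is_tile_def)
    then show ?thesis
      by (simp add: q_def shift_tile_def box_corner_translate)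
  qed
  have "\<exists>v d e. d > 0 \<and> e > 0 \<and> (\<forall>t. is_tile t \<and> prototile t = P \<longrightarrow>
          ball (q t + v) d \<subseteq> fst t \<and> fst t \<subseteq> ball (q t + v) e)" if "P \<in> \<P>" for P
  proof -
    obtain t where t: "is_tile t" "P = prototile t"
      using \<open>P \<in> \<P>\<close> assms unfolding prototile_collection_def by blast
    obtain c where "c \<in> interior (fst t)"
      using is_tile_interior_nonempty[OF t(1)] by blast
    then obtain d where c: "d > 0" "ball c d \<subseteq> fst t"
      unfolding mem_interior by blast
    have "bounded (fst t)"
      using t(1) compact_imp_bounded by (auto simp: is_tile_def)
    then obtain e where e: "e > 0" "fst t \<subseteq> ball c e"
      using bounded_subset_ballD by blast
    have "ball (q s + (c - q t)) d \<subseteq> fst s \<and> fst s \<subseteq> ball (q s + (c - q t)) e"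
      if "is_tile s" "prototile s = P" for s
    proof -
      have "s \<in> prototile s"
        unfolding prototile_def by (metis rangeI shift_tile_0)
      then obtain x where x: "s = shift_tile t x"
        using \<open>prototile s = P\<close> t unfolding prototile_def by blast
      have "q s + (c - q t) = c - x"
        using q[OF t(1)] x by simp
      moreover have "ball (c - x) \<rho> = (\<lambda>y. y - x) ` ball c \<rho>" for \<rho>
        using ball_translation[of "- x" c \<rho>] by simp
      ultimately have centre: "ball (q s + (c - q t)) \<rho> = (\<lambda>y. y - x) ` ball c \<rho>" for \<rho>
        by (simp only:)
      have supp: "fst s = (\<lambda>y. y - x) ` fst t"
        by (simp add: x shift_tile_def)
      show ?thesis
        unfolding centre supp using image_mono[OF c(2)] image_mono[OF e(2)] by (rule conjI)
    qed
    with c(1) e(1) show ?thesis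
      by (intro exI[of _ "c - q t"] exI[of _ d] exI[of _ e] conjI allI impI) auto
  qed
  then obtain v d e where vde: "\<And>P. P \<in> \<P> \<Longrightarrow> d P > 0 \<and> e P > (0::real) \<and>
      (\<forall>t. is_tile t \<and> prototile t = P \<longrightarrow>
          ball (q t + v P) (d P) \<subseteq> fst t \<and> fst t \<subseteq> ball (q t + v P) (e P))"
    by metis
  define \<delta> where "\<delta> = Min (insert 1 (d ` \<P>))"
  define D where "D = Max (insert 1 (e ` \<P>))"
  have fin: "finite \<P>"
    using assms by (simp add: prototile_collection_def)
  have "\<delta> > 0" "D > 0"
    using fin vde by (auto simp: \<delta>_def D_def less_max_iff_disj Max_gr_iff)
  moreover have "ball c \<delta> \<subseteq> ball c (d P)" "ball c (e P) \<subseteq> ball c D" if "P \<in> \<P>" for c :: 'a and P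
    using fin that by (auto simp: \<delta>_def D_def intro!: subset_ball)
  moreover have "ball (q t + v (prototile t)) (d (prototile t)) \<subseteq> fst t"
    "fst t \<subseteq> ball (q t + v (prototile t)) (e (prototile t))" if "is_tile t" "prototile t \<in> \<P>" for t
    using vde[OF that(2)] that(1) by blast+
  moreover have "q (shift_tile t x) + v (prototile (shift_tile t x)) = q t + v (prototile t) - x"
    if "is_tile t" for t x
    using q[OF that] by (simp add: prototile_shift_tile)
  ultimately have "puncturing \<P> (\<lambda>t. q t + v (prototile t)) \<delta> D"
    unfolding puncturing_def by (metis subset_trans)
  then show ?thesis by (rule that)
qed

context
  fixes \<P> :: "('a::euclidean_space, 'l) tile set set" and p \<delta> D
  assumes punc: "puncturing \<P> p \<delta> D"
begin

lemma puncturingD: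
  assumes "is_tile t" "prototile t \<in> \<P>"
  shows "ball (p t) \<delta> \<subseteq> fst t" "fst t \<subseteq> ball (p t) D" "p (shift_tile t x) = p t - x"
  using punc assms unfolding puncturing_def by metis+

lemma puncture_shift_tile:
  "T \<in> tilings \<P> \<Longrightarrow> t \<in> T \<Longrightarrow> p (shift_tile t x) = p t - x"
  using puncturingD tilingsD by metis

lemma punctures_shift:
  assumes "T \<in> tilings \<P>" "Q \<subseteq> T"
  shows "p ` shift Q x = (\<lambda>y. y - x) ` p ` Q"
proof -
  have "p (shift_tile t x) = p t - x" if "t \<in> Q" for t
    using that assms puncture_shift_tile by blast
  then show ?thesis
    unfolding shift_def by (auto simp: image_image)
qed

lemma ball_puncture_subset: "T \<in> tilings \<P> \<Longrightarrow> t \<in> T \<Longrightarrow> ball (p t) \<delta> \<subseteq> fst t"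
  using puncturingD tilingsD by metis

lemma tile_subset_ball_puncture: "T \<in> tilings \<P> \<Longrightarrow> t \<in> T \<Longrightarrow> fst t \<subseteq> ball (p t) D"
  using puncturingD tilingsD by metis

lemma puncturing_pos: "\<delta> > 0" "D > 0"
  using punc by (auto simp: puncturing_def)

lemma puncture_in_tile: "T \<in> tilings \<P> \<Longrightarrow> t \<in> T \<Longrightarrow> p t \<in> fst t"
  using ball_puncture_subset puncturing_pos by fastforce

lemma punctures_separated:
  assumes T: "T \<in> tilings \<P>" "s \<in> T" "t \<in> T" and "dist (p s) (p t) < \<delta>"
  shows "s = t"
proof (rule ccontr)
  assume "s \<noteq> t"
  then have "interior (fst s \<inter> fst t) = {}"
    using T by (auto simp: tilings_def)
  moreover have "ball (p s) \<delta> \<inter> ball (p t) \<delta> \<subseteq> interior (fst s \<inter> fst t)"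
    using ball_puncture_subset[OF T(1,2)] ball_puncture_subset[OF T(1,3)]
    by (intro interior_maximal) blast+
  moreover have "p t \<in> ball (p s) \<delta> \<inter> ball (p t) \<delta>"
    using assms puncturing_pos by auto
  ultimately show False by blast
qed

lemma exists_near_puncture:
  assumes "T \<in> tilings \<P>"
  obtains t where "t \<in> T" "x \<in> fst t" "dist (p t) x < D"
proof -
  obtain t where t: "t \<in> T" "x \<in> fst t"
    by (rule exists_tile_at[OF assms])
  moreover have "dist (p t) x < D"
    using tile_subset_ball_puncture[OF assms t(1)] t(2) by auto
  ultimately show ?thesis
    by (rule that)
qed

text \<open>If two translates of a tiling share the tile at \<open>c\<close>, then this tile comes from two tiles of
  the tiling whose punctures differ by the difference of the translations. So translations
  by distinct nearby vectors never lead to the same patch, however small the patch is.\<close>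

lemma translation_unique:
  assumes T: "T \<in> tilings \<P>" and eq: "patch (shift T z) c r = patch (shift T z') c r"
    and r: "r > 0" and z: "norm (z - z') < \<delta>"
  shows "z = z'"
proof -
  obtain u where u: "u \<in> shift T z" "c \<in> fst u"
    by (rule exists_tile_at[OF shift_in_tilings[OF T, of z]])
  then have "u \<in> patch (shift T z) c r"
    using r by (auto simp: patch_def)
  with eq have "u \<in> shift T z'"
    by (auto simp: patch_def)
  with u obtain s s' where s: "s \<in> T" "s' \<in> T" "u = shift_tile s z" "u = shift_tile s' z'"
    by (auto simp: shift_def)
  then have *: "p s - z = p s' - z'"
    using puncture_shift_tile[OF T] by metis
  then have "p s - p s' = z - z'"
    by (simp add: algebra_simps)
  then have "s = s'"
    using punctures_separated[OF T s(1,2)] z by (simp add: dist_norm)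
  with * show ?thesis by simp
qed

end

text \<open>Cover the ball by finitely many balls of radius \<open>\<delta> / 2\<close>: a \<open>\<delta>\<close>-separated set has at most one point
  in each of them. The number of balls is the uniform bound.\<close>

lemma finite_card_separated_bound:
  assumes "\<delta> > 0"
  obtains N where "\<And>S :: 'a::euclidean_space set. S \<subseteq> ball 0 r \<Longrightarrow>
    (\<And>s t. s \<in> S \<Longrightarrow> t \<in> S \<Longrightarrow> dist s t < \<delta> \<Longrightarrow> s = t) \<Longrightarrow> finite S \<and> card S \<le> N"
proof -
  have "cball (0::'a) r \<subseteq> (\<Union>c\<in>cball 0 r. ball c (\<delta> / 2))"
    using assms by force
  then obtain k where k: "k \<subseteq> cball (0::'a) r" "finite k" "cball 0 r \<subseteq> (\<Union>c\<in>k. ball c (\<delta> / 2))"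
    by (rule compactE_image[OF compact_cball, rotated]) auto
  have "finite S \<and> card S \<le> card k"
    if S: "S \<subseteq> ball 0 r" and sep: "\<And>s t. s \<in> S \<Longrightarrow> t \<in> S \<Longrightarrow> dist s t < \<delta> \<Longrightarrow> s = t"
    for S :: "'a set"
  proof -
    have "\<exists>c\<in>k. dist c s < \<delta> / 2" if "s \<in> S" for s
    proof -
      have "s \<in> cball 0 r"
        using S that ball_subset_cball by blast
      then have "s \<in> (\<Union>c\<in>k. ball c (\<delta> / 2))"
        using k(3) by blast
      then show ?thesis by simp
    qed
    then obtain c where c: "\<And>s. s \<in> S \<Longrightarrow> c s \<in> k \<and> dist (c s) s < \<delta> / 2"
      by metis
    have "inj_on c S"
    proof
      fix s t assume st: "s \<in> S" "t \<in> S" "c s = c t"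
      then have "dist s t < \<delta>"
        using c[of s] c[of t] dist_triangle[of s t "c s"] by (simp add: dist_commute)
      with sep st show "s = t" by blast
    qed
    moreover have "c ` S \<subseteq> k"
      using c by blast
    ultimately show ?thesis
      using k(2) inj_on_finite card_inj_on_le by blast
  qed
  then show ?thesis by (rule that)
qed

definition transversal ::
    "('a::euclidean_space, 'l) tile set set \<Rightarrow> (('a, 'l) tile \<Rightarrow> 'a) \<Rightarrow> ('a, 'l) tile set set" where
  "transversal \<Omega> p = {T \<in> \<Omega>. 0 \<in> p ` T}"

context
  fixes \<P> :: "('a::euclidean_space, 'l) tile set set" and p \<delta> D
  assumes punc: "puncturing \<P> p \<delta> D"
begin

lemma finite_patch:
  assumes T: "T \<in> tilings \<P>"
  shows "finite (patch T x r)"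
proof -
  define S where "S = (\<lambda>t. p t - x) ` patch T x r"
  obtain N where N: "\<And>S :: 'a set. S \<subseteq> ball 0 (r + D) \<Longrightarrow>
    (\<And>s t. s \<in> S \<Longrightarrow> t \<in> S \<Longrightarrow> dist s t < \<delta> \<Longrightarrow> s = t) \<Longrightarrow> finite S \<and> card S \<le> N"
    using finite_card_separated_bound[OF puncturing_pos(1)[OF punc]] by blast
  have "dist (p t) x < r + D" if t: "t \<in> patch T x r" for t
  proof -
    obtain y where "y \<in> fst t" "dist x y < r" "t \<in> T"
      using t unfolding patch_def by auto
    moreover from this have "dist (p t) y < D"
      using tile_subset_ball_puncture[OF punc T] by (metis mem_ball subsetD)
    ultimately show ?thesis
      using dist_triangle[of "p t" x y] by (simp add: dist_commute)
  qed
  then have "S \<subseteq> ball 0 (r + D)"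
    unfolding S_def by (auto simp: dist_norm norm_minus_commute)
  moreover have sep: "s = t" if "s \<in> patch T x r" "t \<in> patch T x r" "dist (p s) (p t) < \<delta>" for s t
    using punctures_separated[OF punc T] that patch_subset by blast
  then have "a = b" if "a \<in> S" "b \<in> S" "dist a b < \<delta>" for a b
    using that unfolding S_def by (smt (verit, best) dist_norm diff_diff_eq2 diff_add_cancel imageE)
  ultimately have "finite S"
    using N by blast
  moreover have "inj_on (\<lambda>t. p t - x) (patch T x r)"
    using sep puncturing_pos(1)[OF punc] by (auto simp: inj_on_def)
  ultimately show ?thesis
    unfolding S_def by (rule finite_imageD)
qed

text \<open>Locality holds with both radii equal to 1, since a tile contains its puncture: a puncture in a
  ball belongs to a tile that meets this ball.\<close>

lemma local_pointing_rule_punctures: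
  assumes \<Omega>: "\<Omega> \<subseteq> tilings \<P>"
  shows "local_pointing_rule \<Omega> (\<lambda>T. p ` T)"
proof -
  have "Delaunay (p ` T)" if "T \<in> \<Omega>" for T
  proof -
    have T: "T \<in> tilings \<P>"
      using \<Omega> that by blast
    have "uniform_discrete (p ` T)"
      unfolding uniform_discrete_def
    proof (intro exI[of _ \<delta>] conjI ballI impI)
      fix a b assume "a \<in> p ` T" "b \<in> p ` T" "dist a b < \<delta>"
      then show "a = b"
        using punctures_separated[OF punc T] by blast
    qed (rule puncturing_pos(1)[OF punc])
    moreover have "\<exists>y\<in>p ` T. dist x y \<le> D" for x
    proof -
      obtain t where "t \<in> T" "dist (p t) x < D"
        by (rule exists_near_puncture[OF punc T, of x])
      then show ?thesis
        by (intro bexI[of _ "p t"]) (auto simp: dist_commute)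
    qed
    ultimately show ?thesis
      using puncturing_pos(2)[OF punc] unfolding Delaunay_def by blast
  qed
  moreover have "p ` shift T x = (\<lambda>y. y - x) ` p ` T" if "T \<in> \<Omega>" for T x
    using punctures_shift[OF punc _ subset_refl] \<Omega> that by blast
  moreover have "p ` T \<inter> ball 0 1 = p ` patch T 0 1 \<inter> ball 0 1" if "T \<in> \<Omega>" for T
  proof -
    have "t \<in> patch T 0 1" if "t \<in> T" "p t \<in> ball 0 1" for t
      using puncture_in_tile[OF punc _ that(1)] \<Omega> \<open>T \<in> \<Omega>\<close> that unfolding patch_def by blast
    then show ?thesis
      using patch_subset[of T 0 1] by blast
  qed
  ultimately show ?thesis
    unfolding local_pointing_rule_def by (metis zero_less_one)
qed

lemma canonical_transversal_transversal:
  "\<Omega> \<subseteq> tilings \<P> \<Longrightarrow> canonical_transversal \<Omega> (transversal \<Omega> p)"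
  using local_pointing_rule_punctures unfolding canonical_transversal_def transversal_def by blast

end


section \<open>The hull of a tiling of finite local complexity\<close>

lemma tiling_hull_iff:
  "S \<in> tiling_hull \<P> T \<longleftrightarrow> S \<in> tilings \<P> \<and>
     (\<forall>\<epsilon>>0. \<exists>x. shift T x \<in> tilings \<P> \<and> tiling_dist S (shift T x) < \<epsilon>)"
proof -
  interpret Metric_space "tilings \<P>" tiling_dist
    by (rule Metric_space_tilings)
  show ?thesis
    unfolding tiling_hull_def tiling_topology_def metric_closure_of by auto
qed

lemma tiling_hull_subset: "tiling_hull \<P> T \<subseteq> tilings \<P>"
  unfolding tiling_hull_iff subset_iff by blast

lemma tiling_dist_triangle:
  assumes "S \<in> tilings \<P>" "T \<in> tilings \<P>" "U \<in> tilings \<P>"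
  shows "tiling_dist S U \<le> tiling_dist S T + tiling_dist T U"
  using Metric_space.triangle[OF Metric_space_tilings assms] .

text \<open>For a fixed vector the translation is uniformly continuous: tilings that agree on a large ball up
  to a small translation still do so, on a smaller ball, when the origin is moved by \<open>x\<close>.\<close>

lemma tiling_dist_shift_less:
  fixes x :: "'a::euclidean_space" and \<P> :: "('a, 'l) tile set set"
  assumes "\<epsilon> > 0"
  obtains \<eta> where "\<eta> > 0" "\<And>S T. S \<in> tilings \<P> \<Longrightarrow> T \<in> tilings \<P> \<Longrightarrow>
    tiling_dist S T < \<eta> \<Longrightarrow> tiling_dist (shift S x) (shift T x) < \<epsilon>"
proof -
  have "\<epsilon> / 3 > 0" using assms by simp
  then obtain \<eta> where \<eta>: "\<eta> > 0" "\<And>S T :: ('a, 'l) tile set. tiling_dist S T < \<eta> \<Longrightarrow>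
       \<exists>z. norm z \<le> \<epsilon> / 3 \<and> patch (shift S z) 0 (3 / \<epsilon> + norm x) = patch T 0 (3 / \<epsilon> + norm x)"
    by (rule patch_agree_of_tiling_dist_less) blast
  have "tiling_dist (shift S x) (shift T x) < \<epsilon>"
    if ST: "S \<in> tilings \<P>" "T \<in> tilings \<P>" "tiling_dist S T < \<eta>" for S T
  proof -
    obtain z where z: "norm z \<le> \<epsilon> / 3"
      "patch (shift S z) 0 (3 / \<epsilon> + norm x) = patch (shift T 0) 0 (3 / \<epsilon> + norm x)"
      using \<eta>(2)[OF ST(3)] by (auto simp: shift_0)
    have "patch (shift S (z + x)) (0 - x) (3 / \<epsilon> + norm x) = patch (shift T (0 + x)) (0 - x) (3 / \<epsilon> + norm x)"
      by (rule patch_agree_shift[OF z(2)])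
    then have "patch (shift S (z + x)) 0 (3 / \<epsilon>) = patch (shift T (0 + x)) 0 (3 / \<epsilon>)"
      by (rule patch_eq_subset) (rule ball_subset_ball, simp)
    from tiling_dist_le_of_patch_eq[OF this]
    have "tiling_dist (shift S (z + x)) (shift T x) \<le> \<epsilon> / 3"
      using assms by simp
    moreover have "tiling_dist (shift S x) (shift S (z + x)) \<le> \<epsilon> / 3"
      using tiling_dist_shift_le[of "shift S x" z] z(1) by (simp add: shift_shift add.commute)
    ultimately show ?thesis
      using tiling_dist_triangle[OF shift_in_tilings[OF ST(1), of x]
          shift_in_tilings[OF ST(1), of "z + x"] shift_in_tilings[OF ST(2), of x]] assms by linarith
  qed
  with \<eta>(1) show ?thesis by (rule that)
qed

lemma shift_in_tiling_hull:
  assumes T: "T \<in> tilings \<P>" and S: "S \<in> tiling_hull \<P> T"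
  shows "shift S x \<in> tiling_hull \<P> T"
proof -
  have "\<exists>y. tiling_dist (shift S x) (shift T y) < \<epsilon>" if "\<epsilon> > 0" for \<epsilon>
  proof -
    obtain \<eta> where \<eta>: "\<eta> > 0" "\<And>S T. S \<in> tilings \<P> \<Longrightarrow> T \<in> tilings \<P> \<Longrightarrow>
        tiling_dist S T < \<eta> \<Longrightarrow> tiling_dist (shift S x) (shift T x) < \<epsilon>"
      using tiling_dist_shift_less[OF \<open>\<epsilon> > 0\<close>] by blast
    obtain y where "tiling_dist S (shift T y) < \<eta>"
      using S \<eta>(1) unfolding tiling_hull_iff by blast
    then have "tiling_dist (shift S x) (shift (shift T y) x) < \<epsilon>"
      using \<eta>(2) S shift_in_tilings[OF T] unfolding tiling_hull_iff by blast
    then show ?thesis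
      by (auto simp: shift_shift)
  qed
  then show ?thesis
    using S shift_in_tilings[OF T] shift_in_tilings[of S \<P>] unfolding tiling_hull_iff by blast
qed

text \<open>The hull has no new patches: a tiling that is close to a translate of \<open>T\<close> contains, around the
  origin, an exact copy of a patch of \<open>T\<close>.\<close>

lemma tiling_hull_patch:
  fixes T :: "('a::euclidean_space, 'l) tile set"
  assumes "S \<in> tiling_hull \<P> T"
  obtains x where "patch S 0 r = shift (patch T x r) x"
proof -
  obtain \<epsilon> where \<epsilon>: "\<epsilon> > 0" "\<And>S T :: ('a, 'l) tile set. tiling_dist S T < \<epsilon> \<Longrightarrow>
       \<exists>z. norm z \<le> 1 \<and> patch (shift S z) 0 r = patch T 0 r"
    using patch_agree_of_tiling_dist_less[OF zero_less_one] by blast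
  obtain y where "tiling_dist (shift T y) S < \<epsilon>"
    using assms \<epsilon>(1) unfolding tiling_hull_iff by (metis tiling_dist_commute)
  then obtain z where "patch (shift (shift T y) z) 0 r = patch S 0 r"
    using \<epsilon>(2) by blast
  then have "patch S 0 r = shift (patch T (y + z) r) (y + z)"
    using patch_shift[of T "y + z" 0 r] by (simp add: shift_shift)
  then show ?thesis by (rule that)
qed

text \<open>Finite local complexity leaves finitely many patches up to translation, and each translation class
  contributes finitely many, because the origin has to be one of the finitely many punctures of
  the patch.\<close>

lemma finite_transversal_patches:
  fixes T0 :: "('a::euclidean_space, 'l) tile set"
  assumes punc: "puncturing \<P> p \<delta> D"
    and T0: "T0 \<in> tilings \<P>" and flc: "finite_local_complexity T0"
  shows "finite ((\<lambda>T. patch T 0 r) ` transversal (tiling_hull \<P> T0) p)"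
proof (cases "r > 0")
  case True
  define \<C> where "\<C> = range (\<lambda>x. range (shift (patch T0 x r)))"
  have "patch T 0 r \<in> (\<Union>C\<in>\<C>. {Q \<in> C. 0 \<in> p ` Q})"
    if T: "T \<in> transversal (tiling_hull \<P> T0) p" for T
  proof -
    obtain x where "patch T 0 r = shift (patch T0 x r) x"
      using tiling_hull_patch T unfolding transversal_def by blast
    moreover obtain t where t: "t \<in> T" "p t = 0"
      using T unfolding transversal_def by (metis (mono_tags, lifting) imageE mem_Collect_eq)
    have "T \<in> tilings \<P>"
      using T tiling_hull_subset unfolding transversal_def by blast
    then have "0 \<in> fst t"
      using puncture_in_tile[OF punc] t by metis
    then have "t \<in> patch T 0 r"
      using t(1) True unfolding patch_def by force
    then have "0 \<in> p ` patch T 0 r"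
      using t(2) by (metis image_eqI)
    ultimately show ?thesis
      unfolding \<C>_def by blast
  qed
  moreover have "finite (\<Union>C\<in>\<C>. {Q \<in> C. 0 \<in> p ` Q})"
  proof (rule finite_UN_I)
    show "finite \<C>"
      using flc True unfolding \<C>_def finite_local_complexity_def by blast
    fix C assume "C \<in> \<C>"
    then obtain y where C: "C = range (shift (patch T0 y r))"
      unfolding \<C>_def by blast
    have "{Q \<in> C. 0 \<in> p ` Q} \<subseteq> shift (patch T0 y r) ` p ` patch T0 y r"
    proof
      fix Q assume "Q \<in> {Q \<in> C. 0 \<in> p ` Q}"
      then obtain x where x: "Q = shift (patch T0 y r) x" "0 \<in> p ` Q"
        using C by blast
      then have "x \<in> p ` patch T0 y r"
        using punctures_shift[OF punc T0 patch_subset[of T0 y r], of x] by auto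
      with x(1) show "Q \<in> shift (patch T0 y r) ` p ` patch T0 y r"
        by blast
    qed
    then show "finite {Q \<in> C. 0 \<in> p ` Q}"
      using finite_patch[OF punc T0] by (meson finite_imageI finite_subset)
  qed
  ultimately show ?thesis
    by (meson finite_subset image_subsetI)
next
  case False
  then have "patch T 0 r = {}" for T :: "('a, 'l) tile set"
    by (simp add: patch_def ball_empty)
  then show ?thesis
    by (simp add: finite_subset[of _ "{{}}"] image_subset_iff)
qed

section \<open>Compactness\<close>

text \<open>The limit consists of all tiles that eventually belong to the sequence near the origin. Being a
  tiling is a local property, so it is inherited from the members of the sequence.\<close>

lemma tiling_limit:
  fixes \<tau> :: "nat \<Rightarrow> ('a::euclidean_space, 'l) tile set"
  assumes \<tau>: "\<And>n. \<tau> n \<in> tilings \<P>"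
    and stable: "\<And>k m n. k < m \<Longrightarrow> k < n \<Longrightarrow> patch (\<tau> m) 0 (real k) = patch (\<tau> n) 0 (real k)"
  obtains T where "T \<in> tilings \<P>" "\<And>k n. k < n \<Longrightarrow> patch (\<tau> n) 0 (real k) = patch T 0 (real k)"
proof -
  define T where "T = (\<Union>k. patch (\<tau> (Suc k)) 0 (real k))"
  have patch_T: "patch T 0 (real k) = patch (\<tau> n) 0 (real k)" if "k < n" for k n
  proof
    show "patch T 0 (real k) \<subseteq> patch (\<tau> n) 0 (real k)"
    proof
      fix t assume t: "t \<in> patch T 0 (real k)"
      then obtain j where j: "t \<in> patch (\<tau> (Suc j)) 0 (real j)"
        unfolding T_def patch_def by blast
      define N where "N = Suc (max j k)"
      have "t \<in> patch (\<tau> N) 0 (real j)"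
        using j stable[of j "Suc j" N] by (simp add: N_def)
      then have "t \<in> patch (\<tau> N) 0 (real k)"
        using t unfolding patch_def by blast
      then show "t \<in> patch (\<tau> n) 0 (real k)"
        using stable[of k n N] that by (simp add: N_def)
    qed
    have "patch (\<tau> n) 0 (real k) = patch (\<tau> (Suc k)) 0 (real k)"
      using stable[of k n "Suc k"] that by simp
    then show "patch (\<tau> n) 0 (real k) \<subseteq> patch T 0 (real k)"
      unfolding T_def patch_def by blast
  qed
  have in_\<tau>: "t \<in> \<tau> n" if "t \<in> T" "fst t \<inter> ball 0 (real k) \<noteq> {}" "k < n" for t k n
    using that patch_T[OF that(3)] unfolding patch_def by blast
  have ex_n: "\<exists>n. t \<in> \<tau> n" if "t \<in> T" for t
    using that unfolding T_def patch_def by blast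
  have ex_k: "\<exists>k. fst t \<inter> ball 0 (real k) \<noteq> {}" if "t \<in> T" for t
    using that unfolding T_def patch_def by blast
  have "is_tile t \<and> prototile t \<in> \<P>" if "t \<in> T" for t
    using ex_n[OF that] tilingsD(1,2)[OF \<tau>] by metis
  moreover have "(\<Union>t\<in>T. fst t) = UNIV"
  proof -
    have "\<exists>t\<in>T. x \<in> fst t" for x
    proof -
      obtain k :: nat where k: "norm x < real k"
        using reals_Archimedean2 by blast
      obtain t where t: "t \<in> \<tau> (Suc k)" "x \<in> fst t"
        by (rule exists_tile_at[OF \<tau>])
      then have "t \<in> patch (\<tau> (Suc k)) 0 (real k)"
        using k unfolding patch_def by (auto simp: disjoint_iff)
      with t(2) show ?thesis
        unfolding T_def by blast
    qed
    then show ?thesis by blast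
  qed
  moreover have "interior (fst s \<inter> fst t) = {}" if st: "s \<in> T" "t \<in> T" "s \<noteq> t" for s t
  proof -
    obtain k l where kl: "fst s \<inter> ball 0 (real k) \<noteq> {}" "fst t \<inter> ball 0 (real l) \<noteq> {}"
      using ex_k st by meson
    have "s \<in> \<tau> (Suc (max k l))" "t \<in> \<tau> (Suc (max k l))"
      using in_\<tau>[OF st(1) kl(1)] in_\<tau>[OF st(2) kl(2)] by auto
    with st(3) show ?thesis
      using tilingsD(3)[OF \<tau>] by metis
  qed
  ultimately have "T \<in> tilings \<P>"
    unfolding tilings_def mem_Collect_eq by metis
  then show ?thesis
    using patch_T that by metis
qed

text \<open>The properties of a hull that matter from here on. They make no reference to the tiling that
  generates the hull, so that the two spaces play symmetric roles below.\<close>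

locale punctured_space =
  fixes \<P> :: "('a::euclidean_space, 'l) tile set set" and \<Omega> :: "('a, 'l) tile set set"
    and p :: "('a, 'l) tile \<Rightarrow> 'a" and \<delta> D :: real
  assumes puncturing: "puncturing \<P> p \<delta> D"
    and subset_tilings: "\<Omega> \<subseteq> tilings \<P>"
    and shift_in_space: "S \<in> \<Omega> \<Longrightarrow> shift S x \<in> \<Omega>"
    and finite_patches: "finite ((\<lambda>T. patch T 0 r) ` transversal \<Omega> p)"
begin

lemma exists_shift_in_transversal:
  assumes T: "T \<in> \<Omega>"
  obtains x where "norm x < D" "shift T x \<in> transversal \<Omega> p"
proof -
  have T': "T \<in> tilings \<P>"
    using T subset_tilings by blast
  obtain t where t: "t \<in> T" "dist (p t) 0 < D"
    by (rule exists_near_puncture[OF puncturing T'])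
  have "0 \<in> p ` shift T (p t)"
    using punctures_shift[OF puncturing T' subset_refl] t(1) by force
  then have "shift T (p t) \<in> transversal \<Omega> p"
    unfolding transversal_def using shift_in_space[OF T] by blast
  with t(2) that show ?thesis by simp
qed

text \<open>A diagonal argument: at each integer radius the transversal has finitely many patches, so some
  subsequence has a constant patch there.\<close>

lemma transversal_subseq:
  fixes \<tau> :: "nat \<Rightarrow> ('a, 'l) tile set"
  assumes \<tau>: "\<And>n. \<tau> n \<in> transversal \<Omega> p"
  obtains s where "strict_mono s"
    "\<And>k m n. k < m \<Longrightarrow> k < n \<Longrightarrow> patch (\<tau> (s m)) 0 (real k) = patch (\<tau> (s n)) 0 (real k)"
proof -
  define P where "P k s \<longleftrightarrow> (\<exists>Q. \<forall>i. patch (\<tau> (s i)) 0 (real k) = Q)" for k and s :: "nat \<Rightarrow> nat"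
  interpret subseqs P
  proof
    fix k and s :: "nat \<Rightarrow> nat" assume "strict_mono s"
    have "range (\<lambda>i. patch (\<tau> (s i)) 0 (real k)) \<subseteq>
        (\<lambda>T. patch T 0 (real k)) ` transversal \<Omega> p"
      using \<tau> by blast
    then have "finite (range (\<lambda>i. patch (\<tau> (s i)) 0 (real k)))"
      by (rule finite_subset) (rule finite_patches)
    then have "\<exists>i0\<in>UNIV. infinite {i \<in> UNIV. patch (\<tau> (s i)) 0 (real k) = patch (\<tau> (s i0)) 0 (real k)}"
      by (rule pigeonhole_infinite[OF infinite_UNIV_nat])
    then obtain i0 where
        inf: "infinite {i \<in> UNIV. patch (\<tau> (s i)) 0 (real k) = patch (\<tau> (s i0)) 0 (real k)}"
      by blast
    obtain r :: "nat \<Rightarrow> nat" where r: "strict_mono r"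
      "\<forall>i. r i \<in> {i \<in> UNIV. patch (\<tau> (s i)) 0 (real k) = patch (\<tau> (s i0)) 0 (real k)}"
      using infinite_enumerate[OF inf] by blast
    then have "P k (s \<circ> r)"
      unfolding P_def by simp
    with r(1) show "\<exists>r'. strict_mono r' \<and> P k (s \<circ> r')"
      by blast
  qed
  have "P k (diagseq \<circ> (+) (Suc k))" for k
  proof (rule diagseq_holds)
    fix r s :: "nat \<Rightarrow> nat" and n
    assume "P n s"
    then show "P n (s \<circ> r)"
      unfolding P_def o_def by blast
  qed
  then have "patch (\<tau> (diagseq m)) 0 (real k) = patch (\<tau> (diagseq n)) 0 (real k)"
    if "k < m" "k < n" for k m n
  proof -
    obtain Q where Q: "\<And>i. patch (\<tau> (diagseq (Suc k + i))) 0 (real k) = Q"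
      using \<open>P k (diagseq \<circ> (+) (Suc k))\<close> unfolding P_def o_def by blast
    have "m = Suc k + (m - Suc k)" "n = Suc k + (n - Suc k)"
      using that by auto
    then show ?thesis
      using Q by metis
  qed
  with subseq_diagseq show ?thesis by (rule that)
qed

text \<open>Translate each tiling of the sequence into the transversal, by a vector of bounded length. Along a
  subsequence these vectors converge and the translated tilings stabilise on every ball, hence
  converge; undoing the translations gives the limit of the given tilings.\<close>

lemma subseq_converges:
  fixes \<sigma> :: "nat \<Rightarrow> ('a, 'l) tile set"
  assumes \<sigma>: "\<And>n. \<sigma> n \<in> \<Omega>"
  obtains T r where "T \<in> tilings \<P>" "strict_mono r" "(\<lambda>n. tiling_dist (\<sigma> (r n)) T) \<longlonglongrightarrow> 0"
proof -
  have "\<exists>x. norm x < D \<and> shift (\<sigma> n) x \<in> transversal \<Omega> p" for n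
    using exists_shift_in_transversal[OF \<sigma>] by metis
  then obtain x where x: "\<And>n. norm (x n) < D"
      "\<And>n. shift (\<sigma> n) (x n) \<in> transversal \<Omega> p"
    by metis
  have "seq_compact (cball (0::'a) D)"
    by (simp add: compact_imp_seq_compact)
  then obtain l r1 where r1: "strict_mono r1" "(x \<circ> r1) \<longlonglongrightarrow> l"
    using x(1) unfolding seq_compact_def by (metis mem_cball_0 less_imp_le)
  obtain r2 where r2: "strict_mono r2" "\<And>k m n. k < m \<Longrightarrow> k < n \<Longrightarrow>
      patch (shift (\<sigma> (r1 (r2 m))) (x (r1 (r2 m)))) 0 (real k) =
      patch (shift (\<sigma> (r1 (r2 n))) (x (r1 (r2 n)))) 0 (real k)"
    using transversal_subseq[of "\<lambda>n. shift (\<sigma> (r1 n)) (x (r1 n))"] x(2) by blast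
  define r where "r = r1 \<circ> r2"
  have r: "strict_mono r"
    unfolding r_def by (rule strict_mono_o[OF r1(1) r2(1)])
  have "shift (\<sigma> (r n)) (x (r n)) \<in> tilings \<P>" for n
    using x(2) subset_tilings unfolding transversal_def by blast
  then obtain T where T: "T \<in> tilings \<P>"
      "\<And>k n. k < n \<Longrightarrow> patch (shift (\<sigma> (r n)) (x (r n))) 0 (real k) = patch T 0 (real k)"
    using tiling_limit[of "\<lambda>n. shift (\<sigma> (r n)) (x (r n))" \<P>] r2(2) unfolding r_def o_def by blast
  have lim: "(\<lambda>n. x (r n)) \<longlonglongrightarrow> l"
    using LIMSEQ_subseq_LIMSEQ[OF r1(2) r2(1)] by (simp add: r_def o_def)
  have hull: "\<sigma> n \<in> tilings \<P>" for n
    using \<sigma> subset_tilings by blast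
  have "(\<lambda>n. tiling_dist (\<sigma> (r n)) (shift T (- l))) \<longlonglongrightarrow> 0"
  proof (rule LIMSEQ_I)
    fix \<epsilon> :: real assume \<epsilon>: "\<epsilon> > 0"
    obtain \<eta> where \<eta>: "\<eta> > 0" "\<And>S T. S \<in> tilings \<P> \<Longrightarrow> T \<in> tilings \<P> \<Longrightarrow>
        tiling_dist S T < \<eta> \<Longrightarrow> tiling_dist (shift S (- l)) (shift T (- l)) < \<epsilon> / 2"
      using tiling_dist_shift_less[of "\<epsilon> / 2" \<P> "- l"] \<epsilon> half_gt_zero by blast
    obtain k :: nat where k: "1 / \<eta> < real k"
      using reals_Archimedean2 by blast
    moreover from this have k': "real k > 0"
      using \<eta>(1) by (meson less_trans zero_less_divide_1_iff)
    ultimately have k_inverse: "1 / real k < \<eta>"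
      using \<eta>(1) by (simp add: field_simps)
    obtain N where N: "\<And>n. n \<ge> N \<Longrightarrow> norm (x (r n) - l) < \<epsilon> / 2"
      using LIMSEQ_D[OF lim, of "\<epsilon> / 2"] \<epsilon> by auto
    have "tiling_dist (\<sigma> (r n)) (shift T (- l)) < \<epsilon>" if n: "n \<ge> max N (Suc k)" for n
    proof -
      have "tiling_dist (shift (\<sigma> (r n)) (x (r n))) T \<le> 1 / real k"
        by (rule tiling_dist_le_of_patch_eq[OF T(2) k']) (use n in auto)
      then have "tiling_dist (shift (\<sigma> (r n)) (x (r n))) T < \<eta>"
        using k_inverse by linarith
      then have "tiling_dist (shift (\<sigma> (r n)) (x (r n) - l)) (shift T (- l)) < \<epsilon> / 2"
        using \<eta>(2)[OF shift_in_tilings[OF hull[of "r n"], of "x (r n)"] T(1)] by (simp add: shift_shift)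
      moreover have "tiling_dist (\<sigma> (r n)) (shift (\<sigma> (r n)) (x (r n) - l)) < \<epsilon> / 2"
        using tiling_dist_shift_le[of "\<sigma> (r n)" "x (r n) - l"] N[of n] n by simp
      ultimately show ?thesis
        using tiling_dist_triangle[OF hull[of "r n"] shift_in_tilings[OF hull[of "r n"], of "x (r n) - l"]
            shift_in_tilings[OF T(1), of "- l"]] by linarith
    qed
    then show "\<exists>no. \<forall>n\<ge>no. norm (tiling_dist (\<sigma> (r n)) (shift T (- l)) - 0) < \<epsilon>"
      by (intro exI[of _ "max N (Suc k)"]) (simp add: tiling_dist_nonneg)
  qed
  with shift_in_tilings[OF T(1)] r show ?thesis by (rule that)
qed

lemma compactin_space:
  assumes closed: "closedin (tiling_topology \<P>) \<Omega>"
  shows "compactin (tiling_topology \<P>) \<Omega>"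
proof -
  interpret Metric_space "tilings \<P>" tiling_dist
    by (rule Metric_space_tilings)
  show ?thesis
    unfolding tiling_topology_def compactin_sequentially
  proof (intro conjI allI impI)
    show "\<Omega> \<subseteq> tilings \<P>"
      by (rule subset_tilings)
    fix \<sigma> :: "nat \<Rightarrow> ('a, 'l) tile set"
    assume "range \<sigma> \<subseteq> \<Omega>"
    then have \<sigma>: "\<sigma> n \<in> \<Omega>" for n
      by blast
    obtain T r where T: "T \<in> tilings \<P>" "strict_mono r" "(\<lambda>n. tiling_dist (\<sigma> (r n)) T) \<longlonglongrightarrow> 0"
      by (rule subseq_converges[OF \<sigma>])
    have \<sigma>_tilings: "\<sigma> n \<in> tilings \<P>" for n
      using \<sigma> subset_tilings by blast
    have lim: "limitin mtopology (\<sigma> \<circ> r) T sequentially"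
      unfolding limit_metric_sequentially
    proof (intro conjI allI impI)
      fix \<epsilon> :: real assume "\<epsilon> > 0"
      then obtain N where "\<And>n. n \<ge> N \<Longrightarrow> norm (tiling_dist (\<sigma> (r n)) T - 0) < \<epsilon>"
        using LIMSEQ_D[OF T(3)] by blast
      then show "\<exists>N. \<forall>n\<ge>N. (\<sigma> \<circ> r) n \<in> tilings \<P> \<and> tiling_dist ((\<sigma> \<circ> r) n) T < \<epsilon>"
        using \<sigma>_tilings by (intro exI[of _ N]) auto
    qed (rule T(1))
    have "closedin mtopology \<Omega>"
      using closed by (simp add: tiling_topology_def)
    then have "T \<in> \<Omega>"
      by (rule limitin_closedin[OF lim _ _ trivial_limit_sequentially]) (simp add: \<sigma>)
    with T(2) lim show "\<exists>l r. l \<in> \<Omega> \<and> strict_mono r \<and> limitin mtopology (\<sigma> \<circ> r) l sequentially"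
      by blast
  qed
qed

end

lemma punctured_space_tiling_hull:
  assumes punc: "puncturing \<P> p \<delta> D"
    and T0: "T0 \<in> tilings \<P>" and flc: "finite_local_complexity T0"
  shows "punctured_space \<P> (tiling_hull \<P> T0) p \<delta> D"
  by unfold_locales
    (use assms tiling_hull_subset shift_in_tiling_hull finite_transversal_patches in blast)+

text \<open>An instance of the Heine--Cantor theorem. Only through this estimate does the topology enter the
  arguments about orbits and complexity.\<close>

lemma uniformly_continuous_on_compact:
  fixes \<P> :: "('a::euclidean_space, 'l) tile set set" and \<P>' :: "('b::euclidean_space, 'k) tile set set"
  assumes com: "compactin (tiling_topology \<P>) \<Omega>"
    and cont: "continuous_map (subtopology (tiling_topology \<P>) \<Omega>)
      (subtopology (tiling_topology \<P>') \<Omega>') h"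
    and \<epsilon>: "\<epsilon> > 0"
  shows "\<exists>\<eta>>0. \<forall>S\<in>\<Omega>. \<forall>T\<in>\<Omega>. tiling_dist S T < \<eta> \<longrightarrow> tiling_dist (h S) (h T) < \<epsilon>"
proof -
  define m1 where "m1 = submetric (metric (tilings \<P>, tiling_dist)) \<Omega>"
  define m2 where "m2 = metric (tilings \<P>', tiling_dist :: ('b, 'k) tile set \<Rightarrow> _)"
  have sub: "\<Omega> \<subseteq> tilings \<P>"
    using compactin_subset_topspace[OF com]
    unfolding tiling_topology_def Metric_space.topspace_mtopology[OF Metric_space_tilings[of \<P>]] .
  note metric_simps = mtopology_of_def tiling_topology_def
    Metric_space.mspace_metric[OF Metric_space_tilings] Metric_space.mdist_metric[OF Metric_space_tilings]
  have "mtopology_of (metric (tilings \<P>, tiling_dist)) = tiling_topology \<P>"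
    by (simp only: metric_simps)
  then have top1: "mtopology_of m1 = subtopology (tiling_topology \<P>) \<Omega>"
    by (simp only: m1_def mtopology_of_submetric)
  have top2: "mtopology_of m2 = tiling_topology \<P>'"
    by (simp only: m2_def metric_simps)
  have "compact_space (mtopology_of m1)"
    unfolding top1 using com by (rule compact_space_subtopology)
  moreover have "continuous_map (mtopology_of m1) (mtopology_of m2) h"
    unfolding top1 top2 using cont by (simp add: continuous_map_in_subtopology)
  ultimately have uc: "uniformly_continuous_map m1 m2 h"
    by (intro continuous_imp_uniformly_continuous_map conjI)
  have "mspace m1 = \<Omega>" "mdist m1 = tiling_dist" "mdist m2 = tiling_dist"
    using sub by (auto simp: m1_def m2_def metric_simps)
  with uc \<epsilon> show ?thesis
    unfolding uniformly_continuous_map_def by (metis tiling_dist_commute)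
qed

lemma closedin_tiling_hull: "closedin (tiling_topology \<P>) (tiling_hull \<P> T)"
  unfolding tiling_hull_def by (rule closedin_closure_of)


section \<open>Uniformly continuous maps and orbits\<close>

lemma exists_previous_step:
  fixes x :: "'a::real_normed_vector"
  assumes "norm x \<le> real (Suc n) * \<tau>"
  obtains y where "norm y \<le> real n * \<tau>" "norm (x - y) \<le> \<tau>"
proof -
  let ?s = "1 / real (Suc n)"
  have n: "norm x * ?s \<le> \<tau>"
    using assms by (simp add: field_simps)
  have x: "x = ?s *\<^sub>R x + (real n * ?s) *\<^sub>R x"
    by (simp add: field_simps flip: scaleR_left_distrib)
  show ?thesis
  proof (rule that)
    show "norm ((real n * ?s) *\<^sub>R x) \<le> real n * \<tau>"
      using mult_left_mono[OF n, of "real n"] by (simp add: mult_ac)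
    have "x - (real n * ?s) *\<^sub>R x = ?s *\<^sub>R x"
      using x by (metis add_diff_cancel_right')
    then show "norm (x - (real n * ?s) *\<^sub>R x) \<le> \<tau>"
      using n by (simp add: mult.commute)
  qed
qed

text \<open>A uniformly continuous map between two such spaces. This is what remains of the homeomorphism in
  the proofs below, once for each of its two directions.\<close>

locale tiling_space_map = dom: punctured_space \<P> \<Omega> p \<delta> D + cod: punctured_space \<P>' \<Omega>' p' \<delta>' D'
  for \<P> :: "('a::euclidean_space, 'l) tile set set" and \<Omega> p \<delta> D
    and \<P>' :: "('a, 'k) tile set set" and \<Omega>' p' \<delta>' D' +
  fixes h :: "('a, 'l) tile set \<Rightarrow> ('a, 'k) tile set"
  assumes map_in: "S \<in> \<Omega> \<Longrightarrow> h S \<in> \<Omega>'"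
    and uniformly_continuous: "\<epsilon> > 0 \<Longrightarrow>
      \<exists>\<eta>>0. \<forall>S\<in>\<Omega>. \<forall>T\<in>\<Omega>. tiling_dist S T < \<eta> \<longrightarrow> tiling_dist (h S) (h T) < \<epsilon>"
begin

lemma image_tiling: "S \<in> \<Omega> \<Longrightarrow> h S \<in> tilings \<P>'"
  using map_in cod.subset_tilings by blast

lemma images_agree:
  assumes "\<kappa> > 0"
  obtains \<eta> where "\<eta> > 0" "\<And>S T. S \<in> \<Omega> \<Longrightarrow> T \<in> \<Omega> \<Longrightarrow> tiling_dist S T < \<eta> \<Longrightarrow>
    \<exists>z. norm z \<le> \<kappa> \<and> patch (shift (h S) z) 0 r = patch (h T) 0 r"
proof -
  obtain \<epsilon> where \<epsilon>: "\<epsilon> > 0" "\<And>S T :: ('a, 'k) tile set. tiling_dist S T < \<epsilon> \<Longrightarrow>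
       \<exists>z. norm z \<le> \<kappa> \<and> patch (shift S z) 0 r = patch T 0 r"
    by (rule patch_agree_of_tiling_dist_less[OF assms]) blast
  obtain \<eta> where \<eta>: "\<eta> > 0" "\<forall>S\<in>\<Omega>. \<forall>T\<in>\<Omega>. tiling_dist S T < \<eta> \<longrightarrow> tiling_dist (h S) (h T) < \<epsilon>"
    using uniformly_continuous[OF \<epsilon>(1)] by blast
  show ?thesis
    by (rule that[OF \<eta>(1)]) (use \<eta>(2) \<epsilon>(2) in blast)
qed

text \<open>The map sends orbits to orbits, and small translations to small translations. Along the segment
  from \<open>S\<close> to \<open>S - x\<close>, uniform continuity provides at each point a tiny translation \<open>z\<close> after which
  \<open>h S\<close> looks near the origin like the image of this point, and \<open>z\<close> is unique. Now fix a radius and cut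
  the segment so finely that the images of consecutive points agree on a ball of that radius up to
  a tiny translation. By uniqueness, these translations add up to the values of \<open>z\<close>, and since all of
  them are seen from the fixed tiling \<open>h S\<close>, the radius of agreement does not deteriorate with the
  number of steps. As the radius is arbitrary and the endpoint value of \<open>z\<close> does not depend on it,
  \<open>h S\<close> and \<open>h (S - x)\<close> are translates of each other.\<close>

lemma small_translations:
  assumes "\<kappa> > 0"
  obtains \<tau> where "\<tau> > 0" "\<And>S x. S \<in> \<Omega> \<Longrightarrow> norm x \<le> \<tau> \<Longrightarrow>
    \<exists>z. norm z \<le> \<kappa> \<and> h (shift S x) = shift (h S) z"
proof -
  \<comment> \<open>Uniqueness is applied to translations that differ by at most three such lengths.\<close>
  define \<kappa>0 where "\<kappa>0 = min \<kappa> (\<delta>' / 4)"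
  have \<kappa>0: "\<kappa>0 > 0" "\<kappa>0 \<le> \<kappa>" "3 * \<kappa>0 < \<delta>'"
    using assms puncturing_pos(1)[OF cod.puncturing] by (auto simp: \<kappa>0_def)
  obtain \<eta> where \<eta>: "\<eta> > 0" "\<And>S T. S \<in> \<Omega> \<Longrightarrow> T \<in> \<Omega> \<Longrightarrow> tiling_dist S T < \<eta> \<Longrightarrow>
      \<exists>z. norm z \<le> \<kappa>0 \<and> patch (shift (h S) z) 0 1 = patch (h T) 0 1"
    by (rule images_agree[OF \<kappa>0(1), of 1]) blast
  have "\<exists>z. norm z \<le> \<kappa> \<and> h (shift S x) = shift (h S) z"
    if S: "S \<in> \<Omega>" and x: "norm x \<le> \<eta> / 2" for S x
  proof -
    have unique: "z = z'" if "patch (shift (h S) z) 0 1 = patch (shift (h S) z') 0 1" "norm (z - z') < \<delta>'"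
      for z z'
      using translation_unique[OF cod.puncturing image_tiling[OF S] that(1) zero_less_one that(2)] .
    have "\<exists>z. norm z \<le> \<kappa>0 \<and> patch (shift (h S) z) 0 1 = patch (h (shift S (t *\<^sub>R x))) 0 1"
      if "0 \<le> t" "t \<le> 1" for t
    proof (rule \<eta>(2)[OF S dom.shift_in_space[OF S]])
      have "norm (t *\<^sub>R x) \<le> norm x"
        using that mult_right_mono[of t 1 "norm x"] by simp
      then show "tiling_dist S (shift S (t *\<^sub>R x)) < \<eta>"
        using tiling_dist_shift_le[of S "t *\<^sub>R x"] x \<eta>(1) by linarith
    qed
    then obtain z where z: "\<And>t. 0 \<le> t \<Longrightarrow> t \<le> 1 \<Longrightarrow>
        norm (z t) \<le> \<kappa>0 \<and> patch (shift (h S) (z t)) 0 1 = patch (h (shift S (t *\<^sub>R x))) 0 1"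
      by metis
    have "patch (shift (h S) (z 0)) 0 1 = patch (shift (h S) 0) 0 1" "norm (z 0 - 0) \<le> \<kappa>0"
      using z[of 0] by (simp_all add: shift_0)
    then have z0: "z 0 = 0"
      using unique[of "z 0" 0] \<kappa>0 by linarith
    \<comment> \<open>The function \<open>z\<close> is chosen before \<open>r\<close>, so one translation \<open>z 1\<close> serves all radii.\<close>
    have agree: "patch (shift (h S) (z 1)) 0 r = patch (h (shift S x)) 0 r" if "r \<ge> 0" for r
    proof -
      define R where "R = r + 2 * \<kappa>0 + 1"
      obtain \<eta>' where \<eta>': "\<eta>' > 0" "\<And>S T. S \<in> \<Omega> \<Longrightarrow> T \<in> \<Omega> \<Longrightarrow> tiling_dist S T < \<eta>' \<Longrightarrow>
          \<exists>a. norm a \<le> \<kappa>0 \<and> patch (shift (h S) a) 0 (R + 2 * \<kappa>0) = patch (h T) 0 (R + 2 * \<kappa>0)"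
        by (rule images_agree[OF \<kappa>0(1), of "R + 2 * \<kappa>0"]) blast
      obtain n :: nat where "norm x / \<eta>' < real n"
        using reals_Archimedean2 by blast
      moreover from this have n: "n > 0"
        using \<eta>'(1) by (metis divide_nonneg_pos gr0I norm_ge_zero not_le of_nat_0)
      ultimately have xn: "norm x / real n < \<eta>'"
        using \<eta>'(1) by (simp add: field_simps)
      define t where "t j = real j / real n" for j
      define U where "U j = shift S (t j *\<^sub>R x)" for j
      have t: "0 \<le> t j" "t j \<le> 1" if "j \<le> n" for j
        using that n by (auto simp: t_def)
      have U: "U j \<in> \<Omega>" for j
        unfolding U_def by (rule dom.shift_in_space[OF S])
      \<comment> \<open>The balls are centred at the origin of \<open>h S\<close>, so their radius can stay the same for all \<open>j\<close>.\<close>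
      have "patch (shift (h S) (z (t j))) (- z (t j)) R = patch (h (U j)) (- z (t j)) R" if "j \<le> n" for j
        using that
      proof (induction j)
        case 0
        show ?case
          by (simp add: t_def U_def z0 shift_0)
      next
        case (Suc j)
        let ?w = "z (t j)"
        have w: "norm ?w \<le> \<kappa>0"
          using z[OF t(1) t(2)] Suc.prems by simp
        have "t (Suc j) = t j + 1 / real n"
          by (simp add: t_def add_divide_distrib)
        then have "U (Suc j) = shift (U j) ((1 / real n) *\<^sub>R x)"
          unfolding U_def shift_shift by (simp only: scaleR_left_distrib)
        then have "tiling_dist (U j) (U (Suc j)) < \<eta>'"
          using tiling_dist_shift_le[of "U j" "(1 / real n) *\<^sub>R x"] xn by simp
        then obtain a where a: "norm a \<le> \<kappa>0"
            "patch (shift (h (U j)) a) 0 (R + 2 * \<kappa>0) = patch (h (U (Suc j))) 0 (R + 2 * \<kappa>0)"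
          using \<eta>'(2)[OF U U] by blast
        have wa: "norm (?w + a) \<le> 2 * \<kappa>0"
          using norm_triangle_ineq[of ?w a] w a(1) by linarith
        have "patch (shift (h S) ?w) (- ?w) R = patch (shift (h (U j)) 0) (- ?w) R"
          using Suc by (simp add: shift_0)
        from patch_agree_shift[OF this, of a]
        have "patch (shift (h S) (?w + a)) (- (?w + a)) R = patch (shift (h (U j)) a) (- (?w + a)) R"
          by simp
        also have "\<dots> = patch (h (U (Suc j))) (- (?w + a)) R"
          by (rule patch_eq_subset[OF a(2)], rule ball_subset_ball)
             (use wa norm_minus_cancel[of "?w + a"] in simp)
        finally have step: "patch (shift (h S) (?w + a)) (- (?w + a)) R = patch (h (U (Suc j))) (- (?w + a)) R" .
        then have "patch (shift (h S) (?w + a)) 0 1 = patch (h (U (Suc j))) 0 1"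
          by (rule patch_eq_subset) (rule ball_subset_ball, use wa \<open>r \<ge> 0\<close> in \<open>simp add: R_def add.commute\<close>)
        also have "\<dots> = patch (shift (h S) (z (t (Suc j)))) 0 1"
          using z[OF t(1) t(2)] Suc.prems by (simp add: U_def)
        finally have "?w + a = z (t (Suc j))"
        proof (rule unique)
          show "norm (?w + a - z (t (Suc j))) < \<delta>'"
            using z[OF t(1)[of "Suc j"] t(2)[of "Suc j"]] Suc.prems wa \<kappa>0(3)
              norm_triangle_ineq4[of "?w + a" "z (t (Suc j))"] by linarith
        qed
        with step show ?case by simp
      qed
      from this[of n] have "patch (shift (h S) (z 1)) (- z 1) R = patch (h (shift S x)) (- z 1) R"
        using n by (simp add: t_def U_def)
      then show ?thesis
        by (rule patch_eq_subset) (rule ball_subset_ball, use z[of 1] \<kappa>0(1) in \<open>simp add: R_def\<close>)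
    qed
    have "shift (h S) (z 1) = h (shift S x)"
    proof (rule eq_if_patches_eq[OF agree])
      show "\<forall>t\<in>shift (h S) (z 1) \<union> h (shift S x). fst t \<noteq> {}"
        using tile_nonempty[OF shift_in_tilings[OF image_tiling[OF S]]]
          tile_nonempty[OF image_tiling[OF dom.shift_in_space[OF S]]] by blast
    qed
    with z[of 1] \<kappa>0(2) show ?thesis
      by (intro exI[of _ "z 1"]) simp
  qed
  with \<eta>(1) show ?thesis
    by (intro that[of "\<eta> / 2"]) auto
qed

text \<open>Subdivide the segment into steps short enough for the previous lemma: their number, which depends
  on \<open>B\<close> only, bounds the length of the resulting translation.\<close>

lemma bounded_translations:
  obtains K where "\<And>S x. S \<in> \<Omega> \<Longrightarrow> norm x \<le> B \<Longrightarrow>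
    \<exists>y. norm y \<le> K \<and> h (shift S x) = shift (h S) y"
proof -
  obtain \<tau> where \<tau>: "\<tau> > 0" "\<And>S x. S \<in> \<Omega> \<Longrightarrow> norm x \<le> \<tau> \<Longrightarrow>
      \<exists>z. norm z \<le> 1 \<and> h (shift S x) = shift (h S) z"
    by (rule small_translations[OF zero_less_one]) blast
  have *: "\<exists>y. norm y \<le> real n \<and> h (shift S x) = shift (h S) y"
    if S: "S \<in> \<Omega>" and "norm x \<le> real n * \<tau>" for S x n
    using that(2)
  proof (induction n arbitrary: x)
    case 0
    then show ?case
      by (intro exI[of _ 0]) (simp add: shift_0)
  next
    case (Suc n)
    obtain x0 where x0: "norm x0 \<le> real n * \<tau>" "norm (x - x0) \<le> \<tau>"
      by (rule exists_previous_step[OF Suc.prems])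
    obtain y where y: "norm y \<le> real n" "h (shift S x0) = shift (h S) y"
      using Suc.IH[OF x0(1)] by blast
    obtain z where z: "norm z \<le> 1" "h (shift (shift S x0) (x - x0)) = shift (h (shift S x0)) z"
      using \<tau>(2)[OF dom.shift_in_space[OF S] x0(2)] by blast
    have "h (shift S x) = shift (h S) (y + z)"
      using z(2) y(2) by (simp add: shift_shift)
    moreover have "norm (y + z) \<le> real (Suc n)"
      using norm_triangle_ineq[of y z] y(1) z(1) by simp
    ultimately show ?case by blast
  qed
  obtain n :: nat where "B / \<tau> < real n"
    using reals_Archimedean2 by blast
  then have "B \<le> real n * \<tau>"
    using \<tau>(1) by (simp add: field_simps)
  then show ?thesis
    using * by (intro that[of "real n"]) (meson order_trans)
qed

end

section \<open>Homeomorphisms and complexity\<close>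

locale tiling_space_homeomorphism =
  tiling_space_map \<P> \<Omega> p \<delta> D \<P>' \<Omega>' p' \<delta>' D' h +
  inverse: tiling_space_map \<P>' \<Omega>' p' \<delta>' D' \<P> \<Omega> p \<delta> D g
  for \<P> :: "('a::euclidean_space, 'l) tile set set" and \<Omega> p \<delta> D
    and \<P>' :: "('a, 'k) tile set set" and \<Omega>' p' \<delta>' D' h g +
  assumes inverse_left: "S \<in> \<Omega> \<Longrightarrow> g (h S) = S" and inverse_right: "T \<in> \<Omega>' \<Longrightarrow> h (g T) = T"
begin

text \<open>Walk in the target space from \<open>h T\<close> to \<open>h T - y\<close> in short steps. The inverse map turns them into
  short steps \<open>T - x\<close> in the source, and as long as \<open>x\<close> is well inside the ball of radius \<open>r\<close>, the
  tilings \<open>S - x\<close> and \<open>T - x\<close> agree near the origin. So their images agree near the origin up to a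
  tiny translation \<open>z\<close>. Expressed in the frames of \<open>h S\<close> and \<open>h T\<close>, this translation is a vector
  \<open>e\<close> that cannot change from one step to the next, by uniqueness of tiny translations. Hence
  \<open>h S - e\<close> and \<open>h T\<close> agree near every \<open>y\<close> that is reached. The number of steps available is
  proportional to \<open>r\<close>, and so is the distance covered in the target.\<close>

lemma images_agree_on_proportional_ball:
  obtains m r0 where "m > 0" "\<And>S T r. S \<in> \<Omega> \<Longrightarrow> T \<in> \<Omega> \<Longrightarrow> r \<ge> r0 \<Longrightarrow>
    patch S 0 r = patch T 0 r \<Longrightarrow>
    \<exists>e. norm e \<le> 1 \<and> patch (shift (h S) e) 0 (m * r) = patch (h T) 0 (m * r)"
proof -
  \<comment> \<open>Four vectors of length at most \<open>\<kappa>\<close> enter the comparison of two consecutive steps.\<close>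
  define \<kappa> where "\<kappa> = min 1 (\<delta>' / 5)"
  have \<kappa>: "\<kappa> > 0" "\<kappa> \<le> 1" "4 * \<kappa> < \<delta>'"
    using puncturing_pos(1)[OF cod.puncturing] by (auto simp: \<kappa>_def)
  obtain \<eta> where \<eta>: "\<eta> > 0" "\<And>S T. S \<in> \<Omega> \<Longrightarrow> T \<in> \<Omega> \<Longrightarrow> tiling_dist S T < \<eta> \<Longrightarrow>
      \<exists>z. norm z \<le> \<kappa> \<and> patch (shift (h S) z) 0 2 = patch (h T) 0 2"
    by (rule images_agree[OF \<kappa>(1), of 2]) blast
  obtain \<tau> where \<tau>: "\<tau> > 0" "\<And>S x. S \<in> \<Omega> \<Longrightarrow> norm x \<le> \<tau> \<Longrightarrow>
      \<exists>z. norm z \<le> \<kappa> \<and> h (shift S x) = shift (h S) z"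
    by (rule small_translations[OF \<kappa>(1)]) blast
  obtain \<upsilon>' where \<upsilon>': "\<upsilon>' > 0" "\<And>S x. S \<in> \<Omega>' \<Longrightarrow> norm x \<le> \<upsilon>' \<Longrightarrow>
      \<exists>z. norm z \<le> \<tau> \<and> g (shift S x) = shift (g S) z"
    by (rule inverse.small_translations[OF \<tau>(1)]) blast
  define \<upsilon> where "\<upsilon> = min \<upsilon>' \<kappa>"
  have \<upsilon>: "\<upsilon> > 0" "\<upsilon> \<le> \<upsilon>'" "\<upsilon> \<le> \<kappa>"
    using \<upsilon>'(1) \<kappa>(1) by (auto simp: \<upsilon>_def)
  define L where "L = 2 / \<eta>"
  have L: "L > 0" "1 / L < \<eta>"
    using \<eta>(1) by (auto simp: L_def)
  define m where "m = \<upsilon> / (2 * \<tau>)"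
  have "\<exists>e. norm e \<le> 1 \<and> patch (shift (h S) e) 0 (m * r) = patch (h T) 0 (m * r)"
    if S: "S \<in> \<Omega>" and T: "T \<in> \<Omega>" and r: "r \<ge> 2 * (L + \<tau>)" and eq: "patch S 0 r = patch T 0 r" for S T r
  proof -
    have agree: "\<exists>z. norm z \<le> \<kappa> \<and> patch (shift (h (shift S x)) z) 0 2 = patch (h (shift T x)) 0 2"
      if x: "norm x + L \<le> r" for x
    proof (rule \<eta>(2)[OF dom.shift_in_space[OF S] dom.shift_in_space[OF T]])
      have "patch (shift S (0 + x)) (0 - x) r = patch (shift T (0 + x)) (0 - x) r"
        by (rule patch_agree_shift) (simp add: shift_0 eq)
      then have "patch (shift S (0 + x)) 0 L = patch (shift T (0 + x)) 0 L"
        by (rule patch_eq_subset) (rule ball_subset_ball, use x in simp)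
      then show "tiling_dist (shift S x) (shift T x) < \<eta>"
        using tiling_dist_le_of_patch_eq[OF _ L(1), of "shift S x" "shift T x"] L(2) by simp
    qed
    obtain e where e: "norm e \<le> \<kappa>" "patch (shift (h S) e) 0 2 = patch (h T) 0 2"
      using agree[of 0] r L(1) \<tau>(1) by (auto simp: shift_0)
    \<comment> \<open>The vector \<open>e\<close> in the conclusion is the one obtained at the origin, for all \<open>y\<close>.\<close>
    have chain: "\<exists>x z. norm x \<le> real n * \<tau> \<and> h (shift T x) = shift (h T) y \<and> norm z \<le> \<kappa> \<and>
        h (shift S x) = shift (h S) (e + y - z) \<and>
        patch (shift (h S) (e + y)) 0 2 = patch (shift (h T) y) 0 2"
      if "norm y \<le> real n * \<upsilon>" "real n * \<tau> + L \<le> r" for n y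
      using that
    proof (induction n arbitrary: y)
      case 0
      then show ?case
        using e by (intro exI[of _ 0] exI[of _ e]) (simp add: shift_0)
    next
      case (Suc n)
      obtain y0 where y0: "norm y0 \<le> real n * \<upsilon>" "norm (y - y0) \<le> \<upsilon>"
        by (rule exists_previous_step[OF Suc.prems(1)])
      define b where "b = y - y0"
      have b: "norm b \<le> \<upsilon>'" "norm b \<le> \<kappa>" "y = y0 + b"
        using y0(2) \<upsilon> by (auto simp: b_def)
      have "real n * \<tau> + L \<le> r"
        using Suc.prems(2) \<tau>(1) by (simp add: algebra_simps)
      then obtain x z where x: "norm x \<le> real n * \<tau>" "h (shift T x) = shift (h T) y0" "norm z \<le> \<kappa>"
          "h (shift S x) = shift (h S) (e + y0 - z)"
          "patch (shift (h S) (e + y0)) 0 2 = patch (shift (h T) y0) 0 2"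
        using Suc.IH[OF y0(1)] by blast
      obtain u where u: "norm u \<le> \<tau>" "g (shift (h (shift T x)) b) = shift (g (h (shift T x))) u"
        using \<upsilon>'(2)[OF map_in[OF dom.shift_in_space[OF T]] b(1)] by blast
      then have "g (shift (h T) y) = shift T (x + u)"
        using x(2) inverse_left[OF dom.shift_in_space[OF T], of x] by (simp add: shift_shift b(3))
      then have hT: "h (shift T (x + u)) = shift (h T) y"
        using inverse_right[OF cod.shift_in_space[OF map_in[OF T]], of y] by simp
      obtain a where a: "norm a \<le> \<kappa>" "h (shift (shift S x) u) = shift (h (shift S x)) a"
        using \<tau>(2)[OF dom.shift_in_space[OF S] u(1)] by blast
      then have hS: "h (shift S (x + u)) = shift (h S) (e + y0 - z + a)"
        using x(4) by (simp add: shift_shift)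
      have xu: "norm (x + u) \<le> real (Suc n) * \<tau>"
        using norm_triangle_ineq[of x u] x(1) u(1) by (simp add: algebra_simps)
      then obtain z' where z': "norm z' \<le> \<kappa>"
          "patch (shift (h (shift S (x + u))) z') 0 2 = patch (h (shift T (x + u))) 0 2"
        using agree[of "x + u"] Suc.prems(2) by auto
      then have new: "patch (shift (h S) (e + y0 - z + a + z')) 0 2 = patch (shift (h T) y) 0 2"
        by (simp add: hS hT shift_shift)
      have "patch (shift (h S) (e + y0 + b)) (0 - b) 2 = patch (shift (h T) (y0 + b)) (0 - b) 2"
        by (rule patch_agree_shift[OF x(5)])
      \<comment> \<open>The previous comparison, moved by the step \<open>b\<close>: a smaller radius is kept. The new comparison
        holds on the same ball, so the two translations of \<open>h S\<close> coincide.\<close>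
      then have old: "patch (shift (h S) (e + y0 + b)) 0 1 = patch (shift (h T) (y0 + b)) 0 1"
        by (rule patch_eq_subset) (rule ball_subset_ball, use b(2) \<kappa>(2) in simp)
      have "patch (shift (h S) (e + y0 - z + a + z')) 0 1 = patch (shift (h T) y) 0 1"
        by (rule patch_eq_subset[OF new]) (rule subset_ball, simp)
      with old have "patch (shift (h S) (e + y0 - z + a + z')) 0 1 = patch (shift (h S) (e + y0 + b)) 0 1"
        by (simp add: b(3))
      then have "e + y0 - z + a + z' = e + y0 + b"
      proof (rule translation_unique[OF cod.puncturing image_tiling[OF S] _ zero_less_one])
        have "norm (a + z' - (z + b)) \<le> 4 * \<kappa>"
          using norm_triangle_ineq4[of "a + z'" "z + b"] norm_triangle_ineq[of a z']
            norm_triangle_ineq[of z b] a(1) z'(1) x(3) b(2) by linarith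
        moreover have "e + y0 - z + a + z' - (e + y0 + b) = a + z' - (z + b)"
          by (simp add: algebra_simps)
        ultimately show "norm (e + y0 - z + a + z' - (e + y0 + b)) < \<delta>'"
          using \<kappa>(3) by (simp only:)
      qed
      then have "e + y - z' = e + y0 - z + a" "e + y = e + y0 - z + a + z'"
        by (simp_all add: b(3) algebra_simps)
      with xu hT hS z'(1) new show ?case
        by metis
    qed
    \<comment> \<open>The largest number of source steps that stay at distance \<open>L\<close> from the boundary of the ball.\<close>
    define n where "n = nat \<lfloor>(r - L) / \<tau>\<rfloor>"
    have "(r - L) / \<tau> \<ge> 0"
      using r L(1) \<tau>(1) by simp
    then have n: "real n \<le> (r - L) / \<tau>" "(r - L) / \<tau> < real n + 1"
      unfolding n_def by linarith+
    have n1: "real n * \<tau> + L \<le> r"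
      using n(1) \<tau>(1) by (simp add: field_simps)
    have "r - L < (real n + 1) * \<tau>"
      using n(2) \<tau>(1) by (simp add: field_simps)
    then have "r / 2 \<le> real n * \<tau>"
      using r by (simp add: algebra_simps)
    then have "\<upsilon> * (r / 2) \<le> \<upsilon> * (real n * \<tau>)"
      using \<upsilon>(1) by simp
    then have mr: "m * r \<le> real n * \<upsilon>"
      using \<tau>(1) by (simp add: m_def field_simps)
    have local_eq: "patch (shift (h S) e) y 2 = patch (h T) y 2" if y: "norm y < m * r" for y
    proof -
      have "patch (shift (h S) (e + y)) 0 2 = patch (shift (h T) (0 + y)) 0 2"
        using chain[OF _ n1, of y] y mr by auto
      from patch_agree_shift[OF this, of "- y"] show ?thesis
        by (simp add: shift_0)
    qed
    have "t \<in> patch (shift (h S) e) 0 (m * r) \<longleftrightarrow> t \<in> patch (h T) 0 (m * r)" for t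
    proof (cases "fst t \<inter> ball 0 (m * r) = {}")
      case True
      then show ?thesis
        by (simp add: patch_def)
    next
      case False
      then obtain y where y: "y \<in> fst t" "norm y < m * r"
        by auto
      then have near_y: "t \<in> patch U y 2 \<longleftrightarrow> t \<in> U" for U
        unfolding patch_def by (auto simp: disjoint_iff intro: bexI[of _ y])
      have "t \<in> shift (h S) e \<longleftrightarrow> t \<in> h T"
        by (rule trans[OF sym[OF near_y[of "shift (h S) e", unfolded local_eq[OF y(2)]]] near_y])
      then show ?thesis
        unfolding patch_def by simp
    qed
    then have "patch (shift (h S) e) 0 (m * r) = patch (h T) 0 (m * r)"
      by (rule set_eqI)
    moreover have "norm e \<le> 1"
      using e(1) \<kappa>(2) by linarith
    ultimately show ?thesis
      by (intro exI[of _ e] conjI)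
  qed
  moreover have "m > 0"
    using \<upsilon>(1) \<tau>(1) by (simp add: m_def)
  ultimately show ?thesis
    by (intro that[of m "2 * (L + \<tau>)"])
qed

text \<open>Choose a representative in the source transversal for each of its patches \<open>Q\<close> of radius \<open>r\<close>. The
  preimage of a tiling \<open>T\<close> in the target transversal reaches the source transversal by a bounded
  translation; let \<open>Q\<close> be the patch found there. Then \<open>T\<close> and the image of the representative of
  \<open>Q\<close> agree, up to a bounded translation \<open>u\<close>, on a ball of radius proportional to \<open>r\<close>. The origin is
  a puncture of \<open>T\<close>, so \<open>u\<close> is a puncture of the image of the representative. There are at most \<open>N\<close>
  punctures of bounded length, so each \<open>Q\<close> accounts for at most \<open>N\<close> patches in the target.\<close>

lemma complexity_image_le:
  obtains N m where "N > 0" "m > 0"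
    "\<forall>\<^sub>F r in at_top. complexity (transversal \<Omega>' p') (m * r) \<le> N * complexity (transversal \<Omega> p) r"
proof -
  obtain m r0 where m: "m > 0" and images: "\<And>S T r. S \<in> \<Omega> \<Longrightarrow> T \<in> \<Omega> \<Longrightarrow> r \<ge> r0 \<Longrightarrow>
      patch S 0 r = patch T 0 r \<Longrightarrow>
      \<exists>e. norm e \<le> 1 \<and> patch (shift (h S) e) 0 (m * r) = patch (h T) 0 (m * r)"
    by (rule images_agree_on_proportional_ball) blast
  obtain K where K: "\<And>S x. S \<in> \<Omega> \<Longrightarrow> norm x \<le> D \<Longrightarrow>
      \<exists>y. norm y \<le> K \<and> h (shift S x) = shift (h S) y"
    by (rule bounded_translations) blast
  obtain N where N: "\<And>A :: 'a set. A \<subseteq> ball 0 (K + 2) \<Longrightarrow>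
      (\<And>s t. s \<in> A \<Longrightarrow> t \<in> A \<Longrightarrow> dist s t < \<delta>' \<Longrightarrow> s = t) \<Longrightarrow> finite A \<and> card A \<le> N"
    by (rule finite_card_separated_bound[OF puncturing_pos(1)[OF cod.puncturing], of "K + 2"]) blast
  \<comment> \<open>Half of the proportion \<open>m\<close> is given up to absorb the bounded translation of the centre.\<close>
  have "complexity (transversal \<Omega>' p') (m / 2 * r) \<le> Suc N * complexity (transversal \<Omega> p) r"
    if r: "r \<ge> max (max r0 1) (max (2 * K / m) (2 / m))" for r
  proof -
    define X where "X = (\<lambda>T. patch T 0 r) ` transversal \<Omega> p"
    define rep where "rep Q = (SOME S. S \<in> transversal \<Omega> p \<and> patch S 0 r = Q)" for Q
    have rep: "rep Q \<in> transversal \<Omega> p" "patch (rep Q) 0 r = Q" if "Q \<in> X" for Q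
      using someI_ex[of "\<lambda>S. S \<in> transversal \<Omega> p \<and> patch S 0 r = Q"] that
      unfolding X_def rep_def by blast+
    define A where "A Q = p' ` h (rep Q) \<inter> ball 0 (K + 2)" for Q
    have A: "finite (A Q) \<and> card (A Q) \<le> N" if "Q \<in> X" for Q
    proof (rule N)
      have "h (rep Q) \<in> tilings \<P>'"
        using image_tiling rep(1)[OF that] unfolding transversal_def by blast
      then show "s = t" if "s \<in> A Q" "t \<in> A Q" "dist s t < \<delta>'" for s t
        using punctures_separated[OF cod.puncturing] that unfolding A_def by blast
    qed (simp add: A_def)
    define F where "F Q = (\<lambda>u. patch (shift (h (rep Q)) u) 0 (m / 2 * r)) ` A Q" for Q
    have "patch T 0 (m / 2 * r) \<in> (\<Union>Q\<in>X. F Q)" if T: "T \<in> transversal \<Omega>' p'" for T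
    proof -
      have T': "T \<in> \<Omega>'" "0 \<in> p' ` T"
        using T unfolding transversal_def by blast+
      have gT: "g T \<in> \<Omega>"
        by (rule inverse.map_in[OF T'(1)])
      obtain x where x: "norm x < D" "shift (g T) x \<in> transversal \<Omega> p"
        by (rule dom.exists_shift_in_transversal[OF gT])
      obtain y where y: "norm y \<le> K" "h (shift (g T) x) = shift T y"
        using K[OF gT, of x] x(1) inverse_right[OF T'(1)] by auto
      define Q where "Q = patch (shift (g T) x) 0 r"
      have Q: "Q \<in> X"
        using x(2) unfolding X_def Q_def by blast
      have "rep Q \<in> \<Omega>"
        using rep(1)[OF Q] unfolding transversal_def by blast
      then obtain e where e: "norm e \<le> 1"
          "patch (shift (h (rep Q)) e) 0 (m * r) = patch (h (shift (g T) x)) 0 (m * r)"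
        using images[OF _ dom.shift_in_space[OF gT], of "rep Q" r x] rep(2)[OF Q] r
        unfolding Q_def by auto
      define u where "u = e - y"
      have u: "norm u < K + 2"
        using norm_triangle_ineq4[of e y] e(1) y(1) by (simp add: u_def)
      have "patch (shift (h (rep Q)) e) 0 (m * r) = patch (shift T y) 0 (m * r)"
        using e(2) y(2) by simp
      from patch_agree_shift[OF this, of "- y"]
      have "patch (shift (h (rep Q)) u) y (m * r) = patch T y (m * r)"
        by (simp add: shift_0 u_def)
      then have patch_T: "patch (shift (h (rep Q)) u) 0 (m / 2 * r) = patch T 0 (m / 2 * r)"
      proof (rule patch_eq_subset[OF _ ball_subset_ball])
        have "2 * K \<le> m * r"
          using r m by (simp add: field_simps)
        then show "norm (0 - y) + m / 2 * r \<le> m * r"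
          using y(1) by simp
      qed
      obtain t where t: "t \<in> T" "p' t = 0"
        using T'(2) by (metis imageE)
      have "0 \<in> fst t"
        using puncture_in_tile[OF cod.puncturing _ t(1)] t(2) T'(1) cod.subset_tilings by (metis subsetD)
      moreover have "m / 2 * r > 0"
        using r m by simp
      ultimately have "t \<in> patch T 0 (m / 2 * r)"
        using t(1) unfolding patch_def by force
      then have "t \<in> shift (h (rep Q)) u"
        using patch_T patch_subset by blast
      then have "0 \<in> p' ` shift (h (rep Q)) u"
        using t(2) by (metis image_eqI)
      then have "u \<in> p' ` h (rep Q)"
        unfolding punctures_shift[OF cod.puncturing image_tiling[OF \<open>rep Q \<in> \<Omega>\<close>] subset_refl]
        by auto
      then have "u \<in> A Q"
        using u by (simp add: A_def)
      then show ?thesis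
        using Q unfolding F_def patch_T[symmetric] by blast
    qed
    then have sub: "(\<lambda>T. patch T 0 (m / 2 * r)) ` transversal \<Omega>' p' \<subseteq> (\<Union>Q\<in>X. F Q)"
      by blast
    have X: "finite X"
      unfolding X_def by (rule dom.finite_patches)
    have F: "finite (F Q)" "card (F Q) \<le> N" if "Q \<in> X" for Q
      using A[OF that] card_image_le[of "A Q"] unfolding F_def by (auto intro: order_trans)
    have "complexity (transversal \<Omega>' p') (m / 2 * r) \<le> card (\<Union>Q\<in>X. F Q)"
      unfolding complexity_def by (rule card_mono[OF _ sub]) (use X F(1) in blast)
    also have "\<dots> \<le> (\<Sum>Q\<in>X. card (F Q))"
      by (rule card_UN_le[OF X])
    also have "\<dots> \<le> card X * N"
      using sum_bounded_above[of X "\<lambda>Q. card (F Q)" N] F(2) by simp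
    finally show ?thesis
      by (simp add: complexity_def X_def mult.commute)
  qed
  then have "\<forall>\<^sub>F r in at_top.
      complexity (transversal \<Omega>' p') (m / 2 * r) \<le> Suc N * complexity (transversal \<Omega> p) r"
    unfolding eventually_at_top_linorder by blast
  moreover have "m / 2 > 0"
    using m by simp
  ultimately show ?thesis
    by (intro that[of "Suc N" "m / 2"] zero_less_Suc)
qed

end

theorem theorem3p1:
  fixes \<P> :: "(real ^ 'n, 'l) tile set set"
    and \<P>' :: "(real ^ 'n, 'k) tile set set"
    and \<Omega> :: "(real ^ 'n, 'l) tile set set"
    and \<Omega>' :: "(real ^ 'n, 'k) tile set set"
    and h :: "(real ^ 'n, 'l) tile set \<Rightarrow> (real ^ 'n, 'k) tile set"
  assumes "prototile_collection \<P>" and "prototile_collection \<P>'"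
    and "aperiodic_repetitive_FLC_space \<P> \<Omega>"
    and "aperiodic_repetitive_FLC_space \<P>' \<Omega>'"
    and "homeomorphic_map (subtopology (tiling_topology \<P>) \<Omega>)
           (subtopology (tiling_topology \<P>') \<Omega>') h"
  shows "\<exists>\<Xi> \<Xi>'. canonical_transversal \<Omega> \<Xi> \<and> canonical_transversal \<Omega>' \<Xi>' \<and>
    (\<exists>c C m M :: real. c > 0 \<and> C > 0 \<and> m > 0 \<and> M > 0 \<and>
      (\<forall>\<^sub>F r in at_top.
         c * real (complexity \<Xi>' (m * r)) \<le> real (complexity \<Xi> r) \<and>
         real (complexity \<Xi> r) \<le> C * real (complexity \<Xi>' (M * r))))"
proof -
  obtain p \<delta> D where p: "puncturing \<P> p \<delta> D"
    by (rule exists_puncturing[OF assms(1)])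
  obtain p' \<delta>' D' where p': "puncturing \<P>' p' \<delta>' D'"
    by (rule exists_puncturing[OF assms(2)])
  obtain T0 where T0: "T0 \<in> tilings \<P>" "finite_local_complexity T0" "\<Omega> = tiling_hull \<P> T0"
    using assms(3) unfolding aperiodic_repetitive_FLC_space_def by blast
  obtain T0' where T0': "T0' \<in> tilings \<P>'" "finite_local_complexity T0'" "\<Omega>' = tiling_hull \<P>' T0'"
    using assms(4) unfolding aperiodic_repetitive_FLC_space_def by blast
  interpret dom: punctured_space \<P> \<Omega> p \<delta> D
    unfolding T0(3) by (rule punctured_space_tiling_hull[OF p T0(1,2)])
  interpret cod: punctured_space \<P>' \<Omega>' p' \<delta>' D'
    unfolding T0'(3) by (rule punctured_space_tiling_hull[OF p' T0'(1,2)])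
  have compact: "compactin (tiling_topology \<P>) \<Omega>" "compactin (tiling_topology \<P>') \<Omega>'"
    by (rule dom.compactin_space cod.compactin_space, simp add: T0(3) T0'(3) closedin_tiling_hull)+
  have top: "topspace (subtopology (tiling_topology \<P>) \<Omega>) = \<Omega>"
      "topspace (subtopology (tiling_topology \<P>') \<Omega>') = \<Omega>'"
    using compact compactin_subset_topspace by (metis topspace_subtopology_subset)+
  obtain g where hg: "homeomorphic_maps (subtopology (tiling_topology \<P>) \<Omega>)
      (subtopology (tiling_topology \<P>') \<Omega>') h g"
    using assms(5) unfolding homeomorphic_map_maps by blast
  then have cont: "continuous_map (subtopology (tiling_topology \<P>) \<Omega>)
        (subtopology (tiling_topology \<P>') \<Omega>') h"
      "continuous_map (subtopology (tiling_topology \<P>') \<Omega>')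
        (subtopology (tiling_topology \<P>) \<Omega>) g"
    and inv: "\<And>S. S \<in> \<Omega> \<Longrightarrow> g (h S) = S" "\<And>T. T \<in> \<Omega>' \<Longrightarrow> h (g T) = T"
    unfolding homeomorphic_maps_def top by blast+
  have maps: "\<And>S. S \<in> \<Omega> \<Longrightarrow> h S \<in> \<Omega>'" "\<And>T. T \<in> \<Omega>' \<Longrightarrow> g T \<in> \<Omega>"
    using continuous_map_image_subset_topspace[OF cont(1)]
      continuous_map_image_subset_topspace[OF cont(2)] unfolding top by blast+
  interpret h: tiling_space_map \<P> \<Omega> p \<delta> D \<P>' \<Omega>' p' \<delta>' D' h
    by unfold_locales (rule maps(1), assumption, rule uniformly_continuous_on_compact[OF compact(1) cont(1)])
  interpret g: tiling_space_map \<P>' \<Omega>' p' \<delta>' D' \<P> \<Omega> p \<delta> D g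
    by unfold_locales (rule maps(2), assumption, rule uniformly_continuous_on_compact[OF compact(2) cont(2)])
  interpret hg: tiling_space_homeomorphism \<P> \<Omega> p \<delta> D \<P>' \<Omega>' p' \<delta>' D' h g
    by unfold_locales (rule inv; assumption)+
  interpret gh: tiling_space_homeomorphism \<P>' \<Omega>' p' \<delta>' D' \<P> \<Omega> p \<delta> D g h
    by unfold_locales (rule inv; assumption)+
  let ?\<Xi> = "transversal \<Omega> p" and ?\<Xi>' = "transversal \<Omega>' p'"
  obtain N m where m: "N > 0" "m > 0"
      "\<forall>\<^sub>F r in at_top. complexity ?\<Xi>' (m * r) \<le> N * complexity ?\<Xi> r"
    by (rule hg.complexity_image_le)
  obtain C n where n: "C > 0" "n > 0"
      "\<forall>\<^sub>F r in at_top. complexity ?\<Xi> (n * r) \<le> C * complexity ?\<Xi>' r"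
    by (rule gh.complexity_image_le)
  \<comment> \<open>The inequality for the inverse bounds the complexity of \<open>?\<Xi>\<close> at \<open>n * r\<close>; rescale the radius.\<close>
  have "filterlim (\<lambda>r. inverse n * r) at_top at_top"
    using n(2) by (intro filterlim_tendsto_pos_mult_at_top[OF tendsto_const]) (auto simp: filterlim_ident)
  from eventually_compose_filterlim[OF n(3) this]
  have "\<forall>\<^sub>F r in at_top. complexity ?\<Xi> r \<le> C * complexity ?\<Xi>' (inverse n * r)"
    using n(2) by (simp add: mult.assoc[symmetric])
  with m(3) have "\<forall>\<^sub>F r in at_top.
      1 / real N * real (complexity ?\<Xi>' (m * r)) \<le> real (complexity ?\<Xi> r) \<and>
      real (complexity ?\<Xi> r) \<le> real C * real (complexity ?\<Xi>' (inverse n * r))"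
  proof eventually_elim
    case (elim r)
    have "real (complexity ?\<Xi>' (m * r)) \<le> real N * real (complexity ?\<Xi> r)"
      using elim(1) by (simp only: of_nat_mult[symmetric] of_nat_le_iff)
    moreover have "real (complexity ?\<Xi> r) \<le> real C * real (complexity ?\<Xi>' (inverse n * r))"
      using elim(2) by (simp only: of_nat_mult[symmetric] of_nat_le_iff)
    ultimately show ?case
      using m(1) by (simp add: field_simps)
  qed
  moreover have "canonical_transversal \<Omega> ?\<Xi>" "canonical_transversal \<Omega>' ?\<Xi>'"
    by (rule canonical_transversal_transversal[OF p dom.subset_tilings]
        canonical_transversal_transversal[OF p' cod.subset_tilings])+
  moreover have "1 / real N > 0" "real C > 0" "inverse n > 0"
    using m(1) n(1,2) by auto
  ultimately show ?thesis
    using m(2) by blast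
qed

end
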